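(* Let $(K,v)$ be a valued field, $\overline{K}$ an algebraic closure of $K$, $\overline{v}$ an extension of $v$ to $\overline{K}$, $X$ transcendental over $K$, and $w$ an arbitrary extension of $v$ to $K(X)$. Let $\{Q_i\}_{i\in\Lambda}$ be a complete sequence of key polynomials for $(K(X)|K,w)$, normalized as described in the context. For each $i\in\Lambda$ write $w_i:=w_{Q_i}$ for the $Q_i$-truncation of $w$. Then the following are equivalent: (i) $\{Q_i\}_{i\in\Lambda}$ is regular; (ii) for each $i\in\Lambda$ and each root $a\in\overline{K}$ of $Q_i$, we have $\overline{v}_{a,\delta_w(Q_i)}|_{K(X)} = w_i$.
   Context: Valuations are written additively. Fix a common extension $\overline{w}$ of $w$ and $\overline{v}$ to $\overline{K}(X)$ (restricting to $w$ on $K(X)$ and to $\overline{v}$ on $\overline{K}$). For $a\in\overline{K}$ and $\gamma$ in an ordered abelian group containing $\overline{v}\overline{K}$, $\overline{v}_{a,\gamma}$ is the valuation on $\overline{K}(X)$ with $\overline{v}_{a,\gamma}\left(\sum_i c_i(X-a)^i\right)=\min_i\{\overline{v}c_i+i\gamma\}$ for $c_i\in\overline{K}$. For nonzero $f\in K[X]$, put $\delta_w(f):=\max\{\overline{w}(X-z)\mid z\in\overline{K},\ f(z)=0\}$ (with value $-\infty$ for nonzero constants); this is independent of the choice of $\overline{w}$. A monic nonconstant polynomial $Q\in K[X]$ is a key polynomial for $(K(X)|K,w)$ if for every nonzero $f\in K[X]$, $\deg f<\deg Q$ implies $\delta_w(f)<\delta_w(Q)$. For a monic nonconstant $Q\in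 K[X]$, every $f\in K[X]$ has a unique $Q$-expansion $f=\sum_{i=0}^r f_iQ^i$ with $f_i\in K[X]$, $\deg f_i<\deg Q$ (and $f_r\neq 0$ if $f\ne0$). The $Q$-truncation of $w$ is $w_Q f:=\min_i\{w(f_iQ^i)\}$; it is a valuation on $K(X)$ when $Q$ is a key polynomial. A family $\{Q_i\}_{i\in\Lambda}$ of key polynomials is a complete sequence of key polynomials for $(K(X)|K,w)$ if: (CSKP1) $\delta_w(Q_i)\neq\delta_w(Q_{i'})$ for $i\neq i'$; (CSKP2) $\Lambda$ is well ordered by $i<i'\Leftrightarrow\delta_w(Q_i)<\delta_w(Q_{i'})$; (CSKP3) for every nonconstant $f\in K[X]$ there is $i\in\Lambda$ with $\deg Q_i\leq\deg f$ and $wf=w_{Q_i}f$. Complete sequences are taken in the following normalized form (every extension admits such a sequence): (1) $\Lambda=\bigcup_{j\in I}\Lambda_j$ (disjoint) with $I$ an initial segment of $\mathbb{N}=\{0,1,2,\dots\}$; (2) $\Lambda_j=\{j\}\cup\vartheta_j$ for each $j\in I$, with $\vartheta_j$ a possibly empty ordered set without maximal element; (3) $Q_0=X$; (4) $j-1<i<j$ for $j\in I\setminus\{0\}$ and $i\in\vartheta_{j-1}$; (5) $\deg Q_i=\deg Q_{i'}$ for $i,i'\in\Lambda_j$; (6) $\deg Q_i<\deg Q_{i'}$ for $i\in\Lambda_j$, $i'\in\Lambda_{j+1}$; (7) $wQ_i<wQ_{i'}$ and $\delta_w(Q_i)<\delta_w(Q_{i'})$ for $i<i'$ in $\Lambda$.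 For $j\in I\setminus\{0\}$, $Q_j$ is a limit key polynomial if $\vartheta_{j-1}\neq\emptyset$. A limit key polynomial $Q_{j+1}$ is regular if there is $i_0\in\vartheta_j$ such that for all $i\in\vartheta_j$ with $i\geq i_0$ the $Q_i$-expansion of $Q_{j+1}$ has the form $Q_{j+1}=Q_i^n+q_{n-1}Q_i^{n-1}+\dots+q_1Q_i+q_0$ (leading coefficient $1$) and $w_{Q_i}(Q_{j+1})=n\,wQ_i\leq wq_t+t\,wQ_i$ for all $t<n$. The sequence $\{Q_i\}_{i\in\Lambda}$ is regular if every limit key polynomial in it is regular and, for every $j\in I$ with $j+1\in I$ and $\vartheta_j=\emptyset$, the $Q_j$-expansion $Q_{j+1}=q_nQ_j^n+\dots+q_0$ (with $q_n\neq0$) satisfies $q_n=1$ and $w_{Q_j}(Q_{j+1})=n\,wQ_j\leq wq_t+t\,wQ_j$ for all $t<n$. *)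

theory Defs
  imports
    "HOL-Computational_Algebra.Computational_Algebra"
    "HOL-Library.Extended"
begin

section \<open>Valuations\<close>

text \<open>
  Valuations are written additively, with values in an arbitrary ordered abelian group
  extended by \<open>Pinf\<close> (the value of \<open>0\<close>). The element \<open>Minf\<close> is never a value; it only
  serves as \<open>\<delta>(f)\<close> for constant \<open>f\<close>.
\<close>

definition valuation :: "('a::field \<Rightarrow> 'g::linordered_ab_group_add extended) \<Rightarrow> bool" where
  "valuation u \<longleftrightarrow>
     (\<forall>x. u x \<noteq> Minf) \<and>
     (\<forall>x. u x = Pinf \<longleftrightarrow> x = 0) \<and>
     (\<forall>x y. u (x * y) = u x + u y) \<and>
     (\<forall>x y. min (u x) (u y) \<le> u (x + y))"

definition nmult :: "nat \<Rightarrow> 'g::linordered_ab_group_add extended \<Rightarrow> 'g extended" where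
  "nmult n \<gamma> = (\<Sum>_<n. \<gamma>)"

lemma nmult_Fin: "nmult n (Fin (x::'g::linordered_ab_group_add)) = Fin (\<Sum>_<n. x)"
  by (induction n) (auto simp: nmult_def zero_extended_def lessThan_Suc)


section \<open>Algebraic closures and rational function fields\<close>

text \<open>
  The function \<open>\<iota>\<close> exhibits the algebraically closed field \<open>'c\<close> as an algebraic closure of \<open>'k\<close>.
\<close>

definition algebraic_closure_of :: "('k::field \<Rightarrow> 'c::alg_closed_field) \<Rightarrow> bool" where
  "algebraic_closure_of \<iota> \<longleftrightarrow>
     \<iota> 1 = 1 \<and>
     (\<forall>x y. \<iota> (x + y) = \<iota> x + \<iota> y) \<and>
     (\<forall>x y. \<iota> (x * y) = \<iota> x * \<iota> y) \<and>
     (\<forall>z. \<exists>p. p \<noteq> 0 \<and> poly (map_poly \<iota> p) z = 0)"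

text \<open>The embedding of \<open>K(X)\<close> into the rational function field over the algebraic closure.\<close>

definition embed_ratfun :: "('k::field \<Rightarrow> 'c::field) \<Rightarrow> 'k poly fract \<Rightarrow> 'c poly fract" where
  "embed_ratfun \<iota> x =
     (THE y. \<exists>p q. q \<noteq> 0 \<and> x = Fract p q \<and> y = Fract (map_poly \<iota> p) (map_poly \<iota> q))"

lemma embed_ratfun_Fract:
  assumes "algebraic_closure_of \<iota>" "q \<noteq> 0"
  shows "embed_ratfun \<iota> (Fract p q) = Fract (map_poly \<iota> p) (map_poly \<iota> q)"
proof -
  have add: "\<iota> (x + y) = \<iota> x + \<iota> y" and mult: "\<iota> (x * y) = \<iota> x * \<iota> y" and one: "\<iota> 1 = 1" for x y
    using assms(1) by (auto simp: algebraic_closure_of_def)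
  have zero: "\<iota> 0 = 0" using add[of 0 0] by (metis add_0 add_cancel_left_right)
  have inj: "\<iota> x = 0 \<longleftrightarrow> x = 0" for x
    using mult[of x "inverse x"] zero one by (cases "x = 0") auto
  have sum: "\<iota> (sum f A) = (\<Sum>x\<in>A. \<iota> (f x))" if "finite A" for f :: "nat \<Rightarrow> _" and A
    using that by (induction A) (auto simp: zero add)
  have mp: "map_poly \<iota> (a * b) = map_poly \<iota> a * map_poly \<iota> b" for a b
    by (rule poly_eqI) (simp add: coeff_map_poly zero coeff_mult sum mult)
  have mp0: "map_poly \<iota> a = 0 \<longleftrightarrow> a = 0" for a
    using inj zero by (auto simp: poly_eq_iff coeff_map_poly)
  show ?thesis
    unfolding embed_ratfun_def
  proof (rule the_equality)
    show "\<exists>p' q'. q' \<noteq> 0 \<and> Fract p q = Fract p' q' \<and>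
        Fract (map_poly \<iota> p) (map_poly \<iota> q) = Fract (map_poly \<iota> p') (map_poly \<iota> q')"
      using assms(2) by blast
  next
    fix y assume "\<exists>p' q'. q' \<noteq> 0 \<and> Fract p q = Fract p' q' \<and>
        y = Fract (map_poly \<iota> p') (map_poly \<iota> q')"
    then obtain p' q' where *: "q' \<noteq> 0" "Fract p q = Fract p' q'"
      "y = Fract (map_poly \<iota> p') (map_poly \<iota> q')" by blast
    then have "p * q' = p' * q" using assms(2) by (simp add: eq_fract)
    then have "map_poly \<iota> p * map_poly \<iota> q' = map_poly \<iota> p' * map_poly \<iota> q" by (metis mp)
    then show "y = Fract (map_poly \<iota> p) (map_poly \<iota> q)"
      using * assms(2) by (simp add: eq_fract mp0)
  qed
qed

text \<open>
  The extension of a map on polynomials to rational functions by \<open>u (p / q) = u p - u q\<close>.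
  Reading \<open>p / q\<close> in lowest terms with \<open>q\<close> monic makes the definition independent
  of any hypothesis on \<open>u\<close>; if \<open>u\<close> is multiplicative, every other representation of the fraction
  gives the same value.
\<close>

definition fract_val ::
    "('a::field poly \<Rightarrow> 'g::linordered_ab_group_add extended) \<Rightarrow> 'a poly fract \<Rightarrow> 'g extended" where
  "fract_val u x =
     (THE r. \<exists>p q. x = Fract p q \<and> coprime p q \<and> lead_coeff q = 1 \<and> r = u p - u q)"

lemma fract_val_Fract:
  fixes u :: "'a::field poly \<Rightarrow> 'g::linordered_ab_group_add extended"
  assumes mult: "\<And>p q. u (p * q) = u p + u q"
    and fin: "\<And>p. u p \<noteq> Minf" "\<And>p. u p = Pinf \<longleftrightarrow> p = 0"
    and "q \<noteq> 0"
  shows "fract_val u (Fract p q) = u p - u q"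
proof -
  have well: "u p' - u q' = u p - u q" if eq: "Fract p q = Fract p' q'" and nz: "q' \<noteq> 0" for p' q'
  proof -
    have "p * q' = p' * q" using eq nz assms(4) by (simp add: eq_fract)
    then have "u p + u q' = u p' + u q" by (metis mult)
    moreover obtain a b where "u q = Fin a" "u q' = Fin b"
      using fin nz assms(4) by (meson extended.exhaust)
    ultimately show ?thesis
      using fin(1)[of p] fin(1)[of p'] by (cases "u p"; cases "u p'") (auto simp: algebra_simps)
  qed
  obtain g p1 q1 where g: "p = g * p1" "q = g * q1" "coprime p1 q1"
  proof -
    have "\<exists>g p1 q1. p = g * p1 \<and> q = g * q1 \<and> coprime p1 q1"
      using assms(4)
    proof (induction "degree q" arbitrary: p q rule: less_induct)
      case less
      show ?case
      proof (cases "coprime p q")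
        case True then show ?thesis by (metis mult_1)
      next
        case False
        then obtain h where h: "h dvd p" "h dvd q" "\<not> h dvd 1" unfolding coprime_def by blast
        then obtain a b where ab: "p = h * a" "q = h * b" by (auto elim!: dvdE)
        have "degree h > 0" using h less.prems by (metis dvd_0_left_iff is_unit_iff_degree neq0_conv)
        then have "degree b < degree q" "b \<noteq> 0" using ab less.prems by (auto simp: degree_mult_eq)
        from less.hyps[OF this, of a] ab show ?thesis by (metis mult.assoc)
      qed
    qed
    then show ?thesis using that by blast
  qed
  have q1: "q1 \<noteq> 0" "g \<noteq> 0" using g assms(4) by auto
  define c where "c = inverse (lead_coeff q1)"
  have c: "c \<noteq> 0" using q1 by (simp add: c_def)
  have co: "coprime (smult c p1) (smult c q1)"
    using g(3) c unfolding coprime_def by (simp add: dvd_smult_iff)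
  have fr: "Fract p q = Fract (smult c p1) (smult c q1)"
    using g assms(4) q1 c by (simp add: eq_fract mult_ac)
  show ?thesis unfolding fract_val_def
  proof (rule the_equality)
    show "\<exists>p' q'. Fract p q = Fract p' q' \<and> coprime p' q' \<and> lead_coeff q' = 1 \<and> u p - u q = u p' - u q'"
    proof (intro exI conjI)
      show "Fract p q = Fract (smult c p1) (smult c q1)" by (fact fr)
      show "lead_coeff (smult c q1) = 1" using q1 by (simp add: c_def)
      show "u p - u q = u (smult c p1) - u (smult c q1)" using well[OF fr] q1 c by simp
    qed (fact co)
  next
    fix r assume "\<exists>p' q'. Fract p q = Fract p' q' \<and> coprime p' q' \<and> lead_coeff q' = 1 \<and> r = u p' - u q'"
    then obtain p' q' where *: "Fract p q = Fract p' q'" "lead_coeff q' = 1" "r = u p' - u q'" by blast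
    then have "q' \<noteq> 0" by auto
    then show "r = u p - u q" using * well by simp
  qed
qed

text \<open>
  The valuation \<open>v_{a,\<gamma>}\<close>: the coefficients of the expansion of \<open>f\<close> in powers of \<open>X - a\<close> are those
  of \<open>f (X + a)\<close>, so zero coefficients contribute \<open>Pinf\<close> to the minimum.
\<close>

definition mono_val_poly ::
    "('c::field \<Rightarrow> 'g::linordered_ab_group_add extended) \<Rightarrow> 'c \<Rightarrow> 'g extended \<Rightarrow>
     'c poly \<Rightarrow> 'g extended" where
  "mono_val_poly vbar a \<gamma> f =
     Min ((\<lambda>i. vbar (coeff (pcompose f [:a, 1:]) i) + nmult i \<gamma>) ` {..degree f})"

definition mono_val ::
    "('c::field \<Rightarrow> 'g::linordered_ab_group_add extended) \<Rightarrow> 'c \<Rightarrow> 'g extended \<Rightarrow>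
     'c poly fract \<Rightarrow> 'g extended" where
  "mono_val vbar a \<gamma> = fract_val (mono_val_poly vbar a \<gamma>)"


section \<open>Key polynomials and truncations\<close>

definition delta ::
    "('k::field \<Rightarrow> 'c::alg_closed_field) \<Rightarrow>
     ('c poly fract \<Rightarrow> 'g::linordered_ab_group_add extended) \<Rightarrow> 'k poly \<Rightarrow> 'g extended" where
  "delta \<iota> wbar f =
     (if degree f = 0 then Minf
      else Max {wbar (Fract [:- z, 1:] 1) | z. poly (map_poly \<iota> f) z = 0})"

definition key_polynomial ::
    "('k::field \<Rightarrow> 'c::alg_closed_field) \<Rightarrow>
     ('c poly fract \<Rightarrow> 'g::linordered_ab_group_add extended) \<Rightarrow> 'k poly \<Rightarrow> bool" where
  "key_polynomial \<iota> wbar Q \<longleftrightarrow>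
     lead_coeff Q = 1 \<and> degree Q > 0 \<and>
     (\<forall>f. f \<noteq> 0 \<longrightarrow> degree f < degree Q \<longrightarrow> delta \<iota> wbar f < delta \<iota> wbar Q)"

text \<open>
  The \<open>Q\<close>-expansion \<open>f = \<Sum>i\<le>r. f_i * Q ^ i\<close>, encoded as the polynomial with
  coefficients \<open>f_i\<close> in \<open>K[X]\<close> that takes the value \<open>f\<close> at \<open>Q\<close>; so \<open>r\<close> is its degree and \<open>f_r\<close>
  its leading coefficient.
\<close>

definition q_expansion :: "'k::field poly \<Rightarrow> 'k poly \<Rightarrow> 'k poly poly" where
  "q_expansion Q f = (THE c. poly c Q = f \<and> (\<forall>i. degree (coeff c i) < degree Q))"

lemma q_expansion_exists:
  assumes "degree Q > 0"
  shows "\<exists>c. poly c Q = f \<and> (\<forall>i. degree (coeff c i) < degree (Q :: 'k::field poly))"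
proof (induction "degree f" arbitrary: f rule: less_induct)
  case less
  show ?case
  proof (cases "degree f < degree Q")
    case True
    then have "poly [:f:] Q = f \<and> (\<forall>i. degree (coeff [:f:] i) < degree Q)"
      using assms by (auto simp: coeff_pCons split: nat.split)
    then show ?thesis by blast
  next
    case False
    then have "degree (f div Q) < degree f" 
      using assms by (cases "f div Q = 0") (use False degree_mult_eq[of "f div Q" Q] degree_add_eq_left[of "f mod Q" "f div Q * Q"] degree_mod_less'[of Q f] in \<open>fastforce simp: div_mult_mod_eq\<close>)+
    then obtain c where c: "poly c Q = f div Q" "\<forall>i. degree (coeff c i) < degree Q"
      using less by blast
    have "degree (f mod Q) < degree Q"
      using assms degree_mod_less[of Q f] by (cases "Q = 0"; cases "f mod Q = 0") simp_all
    then have "poly (pCons (f mod Q) c) Q = f \<and>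
        (\<forall>i. degree (coeff (pCons (f mod Q) c) i) < degree Q)"
      using c by (auto simp: coeff_pCons mult.commute split: nat.split)
    then show ?thesis by blast
  qed
qed

lemma q_expansion_unique:
  assumes "degree Q > 0"
    and "\<forall>i. degree (coeff c i) < degree Q" "\<forall>i. degree (coeff d i) < degree Q"
    and "poly c Q = poly d (Q :: 'k::field poly)"
  shows "c = d"
  using assms(2-)
proof (induction c arbitrary: d)
  case 0
  then show ?case
  proof (induction d)
    case (pCons b d)
    have b: "degree b < degree Q" using pCons.prems(2) by (metis coeff_pCons_0)
    have d: "\<forall>i. degree (coeff d i) < degree Q" using pCons.prems(2) by (metis coeff_pCons_Suc)
    have eq: "b + Q * poly d Q = 0" using pCons.prems(3) by simp
    have "b mod Q = b" using b by (rule mod_poly_less)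
    moreover have "b = Q * (- poly d Q)" using eq by (simp add: eq_neg_iff_add_eq_0)
    ultimately have "b = 0" by (metis mod_mult_self1_is_0)
    moreover from this eq assms(1) have "poly d Q = 0" by auto
    ultimately show ?case using pCons.IH pCons.prems d pCons.hyps by auto
  qed simp
next
  case (pCons a c)
  obtain b d' where d: "d = pCons b d'" by (cases d)
  have deg: "degree a < degree Q" "degree b < degree Q"
    using pCons.prems(1,2) unfolding d by (metis coeff_pCons_0)+
  have deg': "\<forall>i. degree (coeff c i) < degree Q" "\<forall>i. degree (coeff d' i) < degree Q"
    using pCons.prems(1,2) unfolding d by (metis coeff_pCons_Suc)+
  have eq: "a + Q * poly c Q = b + Q * poly d' Q" using pCons.prems(3) d by simp
  have "a = b" using arg_cong[OF eq, of "\<lambda>x. x mod Q"] deg by (simp add: mod_poly_less)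
  moreover from this eq assms(1) have "poly c Q = poly d' Q" by auto
  ultimately show ?case using pCons.IH[OF deg'] d by simp
qed

lemma q_expansion:
  assumes "degree Q > 0"
  shows "poly (q_expansion Q f) Q = f" "degree (coeff (q_expansion Q f) i) < degree Q"
proof -
  have "\<exists>!c. poly c Q = f \<and> (\<forall>i. degree (coeff c i) < degree Q)"
    using q_expansion_exists[OF assms] q_expansion_unique[OF assms] by metis
  from theI'[OF this] show "poly (q_expansion Q f) Q = f"
    "degree (coeff (q_expansion Q f) i) < degree Q"
    unfolding q_expansion_def by blast+
qed

definition trunc_poly ::
    "('k::field poly fract \<Rightarrow> 'g::linordered_ab_group_add extended) \<Rightarrow> 'k poly \<Rightarrow>
     'k poly \<Rightarrow> 'g extended" where
  "trunc_poly w Q f =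
     Min ((\<lambda>i. w (Fract (coeff (q_expansion Q f) i * Q ^ i) 1)) ` {..degree (q_expansion Q f)})"

definition trunc ::
    "('k::field poly fract \<Rightarrow> 'g::linordered_ab_group_add extended) \<Rightarrow> 'k poly \<Rightarrow>
     'k poly fract \<Rightarrow> 'g extended" where
  "trunc w Q = fract_val (trunc_poly w Q)"


section \<open>Complete sequences of key polynomials\<close>

definition complete_key_sequence ::
    "('k::field \<Rightarrow> 'c::alg_closed_field) \<Rightarrow>
     ('c poly fract \<Rightarrow> 'g::linordered_ab_group_add extended) \<Rightarrow> ('k poly fract \<Rightarrow> 'g extended) \<Rightarrow>
     'i::linorder set \<Rightarrow> ('i \<Rightarrow> 'k poly) \<Rightarrow> bool" where
  "complete_key_sequence \<iota> wbar w \<Lambda> Q \<longleftrightarrow>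
     (\<forall>i\<in>\<Lambda>. key_polynomial \<iota> wbar (Q i)) \<and>
     (\<forall>i\<in>\<Lambda>. \<forall>i'\<in>\<Lambda>. i \<noteq> i' \<longrightarrow> delta \<iota> wbar (Q i) \<noteq> delta \<iota> wbar (Q i')) \<and>
     wfp_on \<Lambda> (<) \<and>
     (\<forall>i\<in>\<Lambda>. \<forall>i'\<in>\<Lambda>. i < i' \<longleftrightarrow> delta \<iota> wbar (Q i) < delta \<iota> wbar (Q i')) \<and>
     (\<forall>f. degree f > 0 \<longrightarrow>
        (\<exists>i\<in>\<Lambda>. degree (Q i) \<le> degree f \<and> w (Fract f 1) = trunc_poly w (Q i) f))"

text \<open>
  The map \<open>e\<close> embeds the initial segment \<open>I\<close> of the natural numbers into the index
  set \<open>\<Lambda>\<close>, i.e. the index \<open>j\<close> is rendered as \<open>e j\<close>; it is injective on \<open>I\<close> because the blocks are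
  disjoint.
\<close>

definition block :: "(nat \<Rightarrow> 'i) \<Rightarrow> (nat \<Rightarrow> 'i set) \<Rightarrow> nat \<Rightarrow> 'i set" where
  "block e \<theta> j = {e j} \<union> \<theta> j"

definition normalized_sequence ::
    "('k::field \<Rightarrow> 'c::alg_closed_field) \<Rightarrow>
     ('c poly fract \<Rightarrow> 'g::linordered_ab_group_add extended) \<Rightarrow> ('k poly fract \<Rightarrow> 'g extended) \<Rightarrow>
     'i::linorder set \<Rightarrow> nat set \<Rightarrow> (nat \<Rightarrow> 'i) \<Rightarrow> (nat \<Rightarrow> 'i set) \<Rightarrow> ('i \<Rightarrow> 'k poly) \<Rightarrow> bool" where
  "normalized_sequence \<iota> wbar w \<Lambda> I e \<theta> Q \<longleftrightarrow>
     0 \<in> I \<and> (\<forall>j\<in>I. \<forall>k<j. k \<in> I) \<and>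
     \<Lambda> = (\<Union>j\<in>I. block e \<theta> j) \<and>
     (\<forall>j\<in>I. \<forall>k\<in>I. j \<noteq> k \<longrightarrow> block e \<theta> j \<inter> block e \<theta> k = {}) \<and>
     (\<forall>j\<in>I. \<forall>i\<in>\<theta> j. \<exists>i'\<in>\<theta> j. i < i') \<and>
     Q (e 0) = [:0, 1:] \<and>
     (\<forall>j. Suc j \<in> I \<longrightarrow> (\<forall>i\<in>\<theta> j. e j < i \<and> i < e (Suc j))) \<and>
     (\<forall>j\<in>I. \<forall>i\<in>block e \<theta> j. \<forall>i'\<in>block e \<theta> j. degree (Q i) = degree (Q i')) \<and>
     (\<forall>j. Suc j \<in> I \<longrightarrow>
        (\<forall>i\<in>block e \<theta> j. \<forall>i'\<in>block e \<theta> (Suc j). degree (Q i) < degree (Q i'))) \<and>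
     (\<forall>i\<in>\<Lambda>. \<forall>i'\<in>\<Lambda>. i < i' \<longrightarrow>
        w (Fract (Q i) 1) < w (Fract (Q i') 1) \<and> delta \<iota> wbar (Q i) < delta \<iota> wbar (Q i'))"

definition regular_expansion ::
    "('k::field poly fract \<Rightarrow> 'g::linordered_ab_group_add extended) \<Rightarrow> 'k poly \<Rightarrow> 'k poly \<Rightarrow> bool" where
  "regular_expansion w Q F \<longleftrightarrow>
     (let q = q_expansion Q F; n = degree q in
        lead_coeff q = 1 \<and>
        trunc_poly w Q F = nmult n (w (Fract Q 1)) \<and>
        (\<forall>t<n. nmult n (w (Fract Q 1)) \<le> w (Fract (coeff q t) 1) + nmult t (w (Fract Q 1))))"

definition regular_sequence ::
    "('k::field poly fract \<Rightarrow> 'g::linordered_ab_group_add extended) \<Rightarrow>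
     nat set \<Rightarrow> (nat \<Rightarrow> 'i::linorder) \<Rightarrow> (nat \<Rightarrow> 'i set) \<Rightarrow> ('i \<Rightarrow> 'k poly) \<Rightarrow> bool" where
  "regular_sequence w I e \<theta> Q \<longleftrightarrow>
     (\<forall>j. Suc j \<in> I \<and> \<theta> j \<noteq> {} \<longrightarrow>
        (\<exists>i\<^sub>0\<in>\<theta> j. \<forall>i\<in>\<theta> j. i\<^sub>0 \<le> i \<longrightarrow> regular_expansion w (Q i) (Q (e (Suc j))))) \<and>
     (\<forall>j. j \<in> I \<and> Suc j \<in> I \<and> \<theta> j = {} \<longrightarrow>
        regular_expansion w (Q (e j)) (Q (e (Suc j))))"

end

theory Submission
  imports Defs
begin

text \<open>
  If \<open>a\<close> is a root of a key polynomial \<open>Q\<close> with \<open>w (X - a) = \<delta>(Q)\<close>, then \<open>v_{a,\<delta>(Q)}\<close> restricts to the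
  truncation \<open>w_Q\<close>; hence \<open>w_Q f = w f\<close> iff \<open>\<delta>(f) \<le> \<delta>(Q)\<close>. Call \<open>Q\<close> uniform if this restriction
  statement holds for all roots of \<open>Q\<close>, and call \<open>a\<close> close to \<open>Q\<close> if \<open>v (a - b) \<ge> \<delta>(Q)\<close> for some root \<open>b\<close>
  of \<open>Q\<close>. For uniform \<open>Q\<close> and monic \<open>f\<close>, summing \<open>min (\<delta>(Q)) (v (a - b))\<close> over all roots \<open>a\<close> of \<open>f\<close> and
  \<open>b\<close> of \<open>Q\<close> in both orders gives \<open>deg Q * w_Q f \<le> deg f * w Q\<close>, with equality iff every root of \<open>f\<close>
  is close to \<open>Q\<close>.

  If the members of the sequence are uniform, then every root of \<open>F = Q_{j+1}\<close> is close to the earlier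
  \<open>Q = Q_i\<close>, so equality holds for \<open>F\<close>. It then also holds for the leading coefficient of the
  \<open>Q\<close>-expansion of \<open>F\<close>, unless this is constant; but a polynomial of degree less than \<open>deg Q\<close> has no
  roots close to \<open>Q\<close>. Conversely, regularity is the equality case, so the roots \<open>a\<close> of \<open>F\<close> are close to
  the uniform \<open>Q_i\<close>. A minimal-degree argument then yields \<open>v (f a) = w f\<close> for all \<open>f\<close> with
  \<open>deg f < deg F\<close>, and expansion of \<open>F\<close> at \<open>a\<close> shows that \<open>F\<close> is uniform.
\<close>

section \<open>Values\<close>

lemma extended_add_mono: "a \<le> b \<Longrightarrow> c \<le> d \<Longrightarrow> a + c \<le> b + (d :: 'g::linordered_ab_group_add extended)"
  by (rule order.trans[OF add_right_mono add_left_mono])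

lemma extended_add_less_le:
  fixes a b c d :: "'g::linordered_ab_group_add extended"
  assumes "a < b" "c \<le> d" "c \<noteq> Minf" "c \<noteq> Pinf"
  shows "a + c < b + d"
  using assms by (cases a; cases b; cases c; cases d) (auto intro: add_less_le_mono)

lemma extended_add_right_cancel:
  fixes a b c :: "'g::linordered_ab_group_add extended"
  assumes "c \<noteq> Minf" "c \<noteq> Pinf"
  shows "a + c = b + c \<longleftrightarrow> a = b"
  using assms by (cases a; cases b; cases c) auto

lemma extended_add_right_le_cancel:
  fixes a b c :: "'g::linordered_ab_group_add extended"
  assumes "c \<noteq> Minf" "c \<noteq> Pinf"
  shows "a + c \<le> b + c \<longleftrightarrow> a \<le> b"
  using assms by (cases a; cases b; cases c) auto

lemma extended_add_Pinf [simp]: "x + Pinf = Pinf" "Pinf + x = Pinf"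
  for x :: "'g::linordered_ab_group_add extended"
  by (cases x; simp)+

lemma extended_add_eq_Pinf_iff:
  "a + b = Pinf \<longleftrightarrow> a = Pinf \<or> b = (Pinf :: 'g::linordered_ab_group_add extended)"
  by (cases a; cases b) auto

lemma extended_add_eq_Minf_iff:
  "a + b = Minf \<longleftrightarrow> (a = Minf \<and> b \<noteq> Pinf) \<or> (b = Minf \<and> a \<noteq> (Pinf :: 'g::linordered_ab_group_add extended))"
  by (cases a; cases b) auto

lemma nmult_0 [simp]: "nmult 0 x = 0"
  by (simp add: nmult_def)

lemma nmult_Suc: "nmult (Suc n) x = nmult n x + x"
  by (simp add: nmult_def lessThan_Suc add.commute)

lemma nmult_1 [simp]: "nmult (Suc 0) x = x"
  by (simp add: nmult_Suc)

lemma nmult_add: "nmult (m + n) x = nmult m x + nmult n x"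
  by (induction n) (simp_all add: nmult_Suc add_ac)

lemma nmult_add_right: "nmult n (x + y) = nmult n x + nmult n y"
  by (induction n) (simp_all add: nmult_Suc add_ac)

lemma nmult_mult: "nmult (m * n) x = nmult m (nmult n x)"
  by (induction m) (simp_all add: nmult_Suc nmult_add add_ac)

lemma nmult_commute: "nmult m (nmult n x) = nmult n (nmult m x)"
  by (simp flip: nmult_mult add: mult.commute)

lemma nmult_neq_Minf: "x \<noteq> Minf \<Longrightarrow> nmult n x \<noteq> Minf"
  by (induction n) (auto simp: nmult_Suc zero_extended_def extended_add_eq_Minf_iff)

lemma nmult_neq_Pinf: "x \<noteq> Pinf \<Longrightarrow> nmult n x \<noteq> Pinf"
  by (induction n) (auto simp: nmult_Suc zero_extended_def extended_add_eq_Pinf_iff)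

lemma nmult_mono: "x \<le> y \<Longrightarrow> nmult n x \<le> nmult n y"
  by (induction n) (auto simp: nmult_Suc intro: extended_add_mono)

lemma nmult_strict_mono:
  assumes "x < y" "x \<noteq> Minf" "0 < n"
  shows "nmult n x < nmult n y"
proof -
  have "x \<noteq> Pinf" using assms by auto
  obtain m where m: "n = Suc m" using assms(3) gr0_implies_Suc by blast
  have "x + nmult m x < y + nmult m y"
    by (rule extended_add_less_le)
       (use assms \<open>x \<noteq> Pinf\<close> in \<open>auto simp: nmult_neq_Minf nmult_neq_Pinf intro: nmult_mono\<close>)
  then show ?thesis by (simp add: m nmult_Suc add.commute)
qed

lemma nmult_le_cancel:
  assumes "nmult n x \<le> nmult n y" "y \<noteq> Minf" "0 < n"
  shows "x \<le> y"
  using nmult_strict_mono[of y x n] assms by force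

lemma nmult_cancel:
  assumes "nmult n x = nmult n y" "x \<noteq> Minf" "y \<noteq> Minf" "0 < n"
  shows "x = y"
  by (rule antisym; rule nmult_le_cancel[of n]) (use assms in simp_all)

lemma sum_mset_const: "(\<Sum>x\<in>#A. c) = nmult (size A) c"
  by (induction A) (simp_all add: nmult_Suc add.commute)

lemma sum_mset_cong': "(\<And>x. x \<in># A \<Longrightarrow> f x = g x) \<Longrightarrow> (\<Sum>x\<in>#A. f x) = (\<Sum>x\<in>#A. g x)"
  by (metis image_mset_cong)

lemma sum_mset_le:
  fixes f g :: "'a \<Rightarrow> 'g::linordered_ab_group_add extended"
  shows "(\<And>x. x \<in># A \<Longrightarrow> f x \<le> g x) \<Longrightarrow> (\<Sum>x\<in>#A. f x) \<le> (\<Sum>x\<in>#A. g x)"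
  by (induction A) (auto intro: extended_add_mono)

lemma sum_mset_neq_Minf:
  fixes f :: "'a \<Rightarrow> 'g::linordered_ab_group_add extended"
  shows "(\<And>x. x \<in># A \<Longrightarrow> f x \<noteq> Minf) \<Longrightarrow> (\<Sum>x\<in>#A. f x) \<noteq> Minf"
  by (induction A) (auto simp: zero_extended_def extended_add_eq_Minf_iff)

lemma sum_mset_neq_Pinf:
  fixes f :: "'a \<Rightarrow> 'g::linordered_ab_group_add extended"
  shows "(\<And>x. x \<in># A \<Longrightarrow> f x \<noteq> Pinf) \<Longrightarrow> (\<Sum>x\<in>#A. f x) \<noteq> Pinf"
  by (induction A) (auto simp: zero_extended_def extended_add_eq_Pinf_iff)

text \<open>The lower summands must be finite: an infinite one would absorb the strict inequality at
  \<open>a\<close>.\<close>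

lemma sum_mset_less:
  fixes f g :: "'a \<Rightarrow> 'g::linordered_ab_group_add extended"
  assumes "\<And>x. x \<in># A \<Longrightarrow> f x \<le> g x" "\<And>x. x \<in># A \<Longrightarrow> f x \<noteq> Minf" "\<And>x. x \<in># A \<Longrightarrow> f x \<noteq> Pinf"
    and "a \<in># A" "f a < g a"
  shows "(\<Sum>x\<in>#A. f x) < (\<Sum>x\<in>#A. g x)"
proof -
  obtain B where A: "A = add_mset a B" using assms(4) by (metis mset_add)
  have "f a + (\<Sum>x\<in>#B. f x) < g a + (\<Sum>x\<in>#B. g x)"
    using assms(1-3) unfolding A
    by (intro extended_add_less_le assms(5) sum_mset_le sum_mset_neq_Minf sum_mset_neq_Pinf) auto
  then show ?thesis by (simp add: A)
qed


section \<open>Valuations\<close>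

text \<open>Valuations whose support need not be zero, such as \<open>f \<mapsto> v (f a)\<close> on polynomials.\<close>

definition semivaluation :: "('a::comm_ring_1 \<Rightarrow> 'g::linordered_ab_group_add extended) \<Rightarrow> bool" where
  "semivaluation u \<longleftrightarrow>
     u 0 = Pinf \<and> u 1 = 0 \<and>
     (\<forall>x. u x \<noteq> Minf) \<and>
     (\<forall>x y. u (x * y) = u x + u y) \<and>
     (\<forall>x y. min (u x) (u y) \<le> u (x + y))"

lemma extended_double_eq_0:
  fixes a :: "'g::linordered_ab_group_add extended"
  shows "a + a = 0 \<Longrightarrow> a = 0"
  by (cases a) (auto simp: zero_extended_def double_zero)

lemma extended_idem_eq_0:
  fixes a :: "'g::linordered_ab_group_add extended"
  shows "a = a + a \<Longrightarrow> a \<noteq> Pinf \<Longrightarrow> a \<noteq> Minf \<Longrightarrow> a = 0"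
  by (cases a) (auto simp: zero_extended_def)

lemma semivaluation_of_valuation:
  assumes "valuation u"
  shows "semivaluation u"
proof -
  have "u 1 = u 1 + u 1" using assms unfolding valuation_def by (metis mult_1)
  moreover have "u 1 \<noteq> Pinf" "u 1 \<noteq> Minf" using assms unfolding valuation_def by auto
  ultimately have "u 1 = 0" by (rule extended_idem_eq_0)
  with assms show ?thesis unfolding valuation_def semivaluation_def by auto
qed

lemma valuation_eq_Pinf_iff: "valuation u \<Longrightarrow> u x = Pinf \<longleftrightarrow> x = 0"
  by (simp add: valuation_def)

context
  fixes u :: "'a::comm_ring_1 \<Rightarrow> 'g::linordered_ab_group_add extended"
  assumes u: "semivaluation u"
begin

lemma semivaluation_0: "u 0 = Pinf"
  and semivaluation_1: "u 1 = 0"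
  and semivaluation_neq_Minf: "u x \<noteq> Minf"
  and semivaluation_mult: "u (x * y) = u x + u y"
  and semivaluation_add: "min (u x) (u y) \<le> u (x + y)"
  using u unfolding semivaluation_def by auto

lemma semivaluation_add_ge: "b \<le> u x \<Longrightarrow> b \<le> u y \<Longrightarrow> b \<le> u (x + y)"
  using semivaluation_add[of x y] by (meson min.boundedI order_trans)

text \<open>The value of -1 doubles to the value of 1, which is 0, and an ordered group has no
  torsion.\<close>

lemma semivaluation_minus: "u (- x) = u x"
proof -
  have "u (- 1) + u (- 1) = 0"
    by (simp flip: semivaluation_mult add: semivaluation_1)
  then have "u (- 1) = 0" by (rule extended_double_eq_0)
  then show ?thesis using semivaluation_mult[of "- 1" x] by simp
qed

lemma semivaluation_minus_commute: "u (x - y) = u (y - x)"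
  using semivaluation_minus[of "x - y"] by simp

lemma semivaluation_diff_ge: "b \<le> u x \<Longrightarrow> b \<le> u y \<Longrightarrow> b \<le> u (x - y)"
  using semivaluation_add_ge[of b x "- y"] by (simp add: semivaluation_minus)

lemma semivaluation_add_eq:
  assumes "u x < u y"
  shows "u (x + y) = u x"
proof (rule antisym)
  show "u x \<le> u (x + y)" using assms by (intro semivaluation_add_ge) auto
  show "u (x + y) \<le> u x"
  proof (rule ccontr)
    assume "\<not> ?thesis"
    then have *: "min (u (x + y)) (u (- y)) > u x"
      using assms by (simp add: semivaluation_minus)
    have "min (u (x + y)) (u (- y)) \<le> u x" using semivaluation_add[of "x + y" "- y"] by simp
    with * show False by (meson leD)
  qed
qed

lemma semivaluation_power: "u (x ^ n) = nmult n (u x)"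
  by (induction n) (simp_all add: semivaluation_1 semivaluation_mult nmult_Suc add.commute)

lemma semivaluation_sum_ge: "(\<And>i. i \<in> A \<Longrightarrow> b \<le> u (f i)) \<Longrightarrow> b \<le> u (\<Sum>i\<in>A. f i)"
  by (induction A rule: infinite_finite_induct)
     (auto simp: semivaluation_0 intro: semivaluation_add_ge)

lemma semivaluation_sum_gt:
  "(\<And>i. i \<in> A \<Longrightarrow> b < u (f i)) \<Longrightarrow> b < Pinf \<Longrightarrow> b < u (\<Sum>i\<in>A. f i)"
  by (induction A rule: infinite_finite_induct)
     (auto simp: semivaluation_0 intro: less_le_trans[OF _ semivaluation_add])

lemma semivaluation_prod_mset: "u (\<Prod>x\<in>#A. f x) = (\<Sum>x\<in>#A. u (f x))"
  by (induction A) (simp_all add: semivaluation_1 semivaluation_mult)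

text \<open>A perturbation of value at least \<open>g\<close> is invisible after cutting off at
  \<open>g\<close>. This is the source of every change of center below.\<close>

lemma semivaluation_min_cong:
  assumes "g \<le> u (x - y)"
  shows "min g (u x) = min g (u y)"
proof -
  have "min g (u y) \<le> u x" using semivaluation_add_ge[of "min g (u y)" "x - y" y] assms by (simp add: min.coboundedI1)
  moreover have "min g (u x) \<le> u y"
    using semivaluation_diff_ge[of "min g (u x)" x "x - y"] assms by (simp add: min.coboundedI1)
  ultimately show ?thesis by (intro antisym min.boundedI) simp_all
qed

end


section \<open>The valuations \<open>v_{a,\<gamma>}\<close>\<close>

lemma Min_image_ge_iff:
  fixes h :: "nat \<Rightarrow> 'a::linorder"
  shows "b \<le> Min (h ` {..n}) \<longleftrightarrow> (\<forall>i\<le>n. b \<le> h i)"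
  by (subst Min_ge_iff) auto

lemma Min_image_attained: "\<exists>i\<le>n. Min (h ` {..n::nat}) = (h i :: 'a::linorder)"
proof -
  have "Min (h ` {..n}) \<in> h ` {..n}" by (rule Min_in) auto
  then obtain i where "i \<in> {..n}" "Min (h ` {..n}) = h i" by (rule imageE)
  then show ?thesis by auto
qed

context
  fixes v :: "'c::field \<Rightarrow> 'g::linordered_ab_group_add extended"
  assumes v: "valuation v"
begin

private lemma sv: "semivaluation v"
  by (rule semivaluation_of_valuation[OF v])

text \<open>Indices beyond the degree contribute \<open>Pinf\<close>, so lower bounds can be tested
  at all indices and the degree need not be carried along.\<close>

lemma mono_val_poly_ge_iff:
  "b \<le> mono_val_poly v a (Fin g) f \<longleftrightarrow>
     (\<forall>i. b \<le> v (coeff (pcompose f [:a, 1:]) i) + nmult i (Fin g))"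
proof -
  have "v (coeff (pcompose f [:a, 1:]) i) + nmult i (Fin g) = Pinf" if "i > degree f" for i
    using that by (simp add: coeff_eq_0 degree_pcompose semivaluation_0[OF sv] nmult_Fin)
  then show ?thesis
    unfolding mono_val_poly_def Min_image_ge_iff by (metis le_Pinf not_le_imp_less)
qed

lemma mono_val_poly_le_coeff:
  "mono_val_poly v a (Fin g) f \<le> v (coeff (pcompose f [:a, 1:]) i) + nmult i (Fin g)"
  using mono_val_poly_ge_iff[of "mono_val_poly v a (Fin g) f" a g f] by blast

lemma mono_val_poly_attained:
  "\<exists>i. mono_val_poly v a (Fin g) f = v (coeff (pcompose f [:a, 1:]) i) + nmult i (Fin g)"
  unfolding mono_val_poly_def
  using Min_image_attained[of "degree f" "\<lambda>i. v (coeff (pcompose f [:a, 1:]) i) + nmult i (Fin g)"] by blast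

lemma mono_val_poly_le_eval: "mono_val_poly v a (Fin g) f \<le> v (poly f a)"
  using mono_val_poly_le_coeff[of a g f 0] by simp

lemma mono_val_poly_neq_Minf: "mono_val_poly v a (Fin g) f \<noteq> Minf"
proof -
  obtain i where i: "mono_val_poly v a (Fin g) f = v (coeff (pcompose f [:a, 1:]) i) + nmult i (Fin g)"
    using mono_val_poly_attained by blast
  show ?thesis
    unfolding i by (simp add: nmult_Fin extended_add_eq_Minf_iff semivaluation_neq_Minf[OF sv])
qed

lemma mono_val_poly_const: "mono_val_poly v a (Fin g) [:c:] = v c"
  by (simp add: mono_val_poly_def)

lemma mono_val_poly_eq_Pinf_iff: "mono_val_poly v a (Fin g) f = Pinf \<longleftrightarrow> f = 0"
proof
  assume *: "mono_val_poly v a (Fin g) f = Pinf"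
  have "v (coeff (pcompose f [:a, 1:]) i) = Pinf" for i
    using mono_val_poly_le_coeff[of a g f i] by (simp add: * nmult_Fin extended_add_eq_Pinf_iff)
  then have "coeff (pcompose f [:a, 1:]) i = 0" for i by (simp add: valuation_eq_Pinf_iff[OF v])
  then have "pcompose f [:a, 1:] = 0" by (simp add: poly_eq_iff)
  then show "f = 0" by (simp add: pcompose_eq_0_iff)
next
  assume "f = 0"
  then show "mono_val_poly v a (Fin g) f = Pinf"
    using mono_val_poly_const[of a g 0] by (simp add: semivaluation_0[OF sv])
qed

lemma mono_val_poly_mono:
  assumes "g \<le> g'"
  shows "mono_val_poly v a (Fin g) f \<le> mono_val_poly v a (Fin g') f"
  unfolding mono_val_poly_ge_iff
proof
  fix i
  show "mono_val_poly v a (Fin g) f \<le> v (coeff (pcompose f [:a, 1:]) i) + nmult i (Fin g')"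
    by (rule order_trans[OF mono_val_poly_le_coeff[of a g f i]])
       (intro add_left_mono nmult_mono, use assms in simp)
qed

lemma mono_val_poly_add:
  "min (mono_val_poly v a (Fin g) f) (mono_val_poly v a (Fin g) h) \<le> mono_val_poly v a (Fin g) (f + h)"
proof (unfold mono_val_poly_ge_iff, intro allI)
  fix i
  let ?f = "coeff (pcompose f [:a, 1:]) i" and ?h = "coeff (pcompose h [:a, 1:]) i"
  let ?m = "min (mono_val_poly v a (Fin g) f) (mono_val_poly v a (Fin g) h)"
  have "?m \<le> min (v ?f + nmult i (Fin g)) (v ?h + nmult i (Fin g))"
    by (meson min.mono mono_val_poly_le_coeff)
  also have "\<dots> = min (v ?f) (v ?h) + nmult i (Fin g)"
    by (simp add: min_add_distrib_left min_def nmult_Fin extended_add_right_le_cancel)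
  also have "\<dots> \<le> v (?f + ?h) + nmult i (Fin g)"
    by (intro add_right_mono semivaluation_add sv)
  finally show "?m \<le> v (coeff (pcompose (f + h) [:a, 1:]) i) + nmult i (Fin g)"
    by (simp add: pcompose_add)
qed

lemma mono_val_poly_least_index:
  assumes "f \<noteq> 0"
  obtains i where "mono_val_poly v a (Fin g) f = v (coeff (pcompose f [:a, 1:]) i) + nmult i (Fin g)"
    and "\<And>j. j < i \<Longrightarrow> mono_val_poly v a (Fin g) f < v (coeff (pcompose f [:a, 1:]) j) + nmult j (Fin g)"
proof -
  define P where "P i \<longleftrightarrow> mono_val_poly v a (Fin g) f = v (coeff (pcompose f [:a, 1:]) i) + nmult i (Fin g)" for i
  have "P (LEAST i. P i)"
    by (rule LeastI_ex) (unfold P_def, rule mono_val_poly_attained)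
  moreover have "\<not> P j" if "j < (LEAST i. P i)" for j
    using that by (rule not_less_Least)
  ultimately show ?thesis
    using that[of "LEAST i. P i"] mono_val_poly_le_coeff[of a g f] unfolding P_def less_le by blast
qed

text \<open>Gauss' lemma: in the product, the two least indices at which the minima are attained give a
  term that nothing can cancel.\<close>

lemma mono_val_poly_mult:
  "mono_val_poly v a (Fin g) (f * h) = mono_val_poly v a (Fin g) f + mono_val_poly v a (Fin g) h"
proof (cases "f = 0 \<or> h = 0")
  case True
  then show ?thesis
    using mono_val_poly_eq_Pinf_iff[of a g f] mono_val_poly_eq_Pinf_iff[of a g h]
      mono_val_poly_eq_Pinf_iff[of a g 0]
    by auto
next
  case False
  define A where "A = coeff (pcompose f [:a, 1:])"
  define B where "B = coeff (pcompose h [:a, 1:])"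
  define Vf where "Vf = mono_val_poly v a (Fin g) f"
  define Vh where "Vh = mono_val_poly v a (Fin g) h"
  have fin: "Vf \<noteq> Pinf" "Vh \<noteq> Pinf" "Vf \<noteq> Minf" "Vh \<noteq> Minf"
    using False by (simp_all add: Vf_def Vh_def mono_val_poly_eq_Pinf_iff mono_val_poly_neq_Minf)
  have coeff: "coeff (pcompose (f * h) [:a, 1:]) n = (\<Sum>i\<le>n. A i * B (n - i))" for n
    by (simp add: pcompose_mult coeff_mult A_def B_def)
  have prd: "v (A i * B j) + nmult (i + j) (Fin g) = (v (A i) + nmult i (Fin g)) + (v (B j) + nmult j (Fin g))" for i j
    by (simp add: semivaluation_mult[OF sv] nmult_add add_ac)
  have leA: "Vf \<le> v (A i) + nmult i (Fin g)" for i
    unfolding Vf_def A_def by (rule mono_val_poly_le_coeff)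
  have leB: "Vh \<le> v (B i) + nmult i (Fin g)" for i
    unfolding Vh_def B_def by (rule mono_val_poly_le_coeff)
  \<comment> \<open>\<open>scale n\<close> adds the weight of index \<open>n\<close>. That weight is
    finite, so \<open>shift\<close> and \<open>unshift\<close> carry bounds back and forth between
    weighted and plain values, where the rules for sums apply.\<close>
  define scale where "scale n x = v x + nmult n (Fin g)" for n x
  have shift: "b \<le> v x \<longleftrightarrow> b + nmult n (Fin g) \<le> scale n x" "b < v x \<longleftrightarrow> b + nmult n (Fin g) < scale n x" for b x and n :: nat
    by (simp_all add: scale_def nmult_Fin extended_add_right_le_cancel less_le extended_add_right_cancel)
  have unshift: "\<exists>b'. b = b' + nmult n (Fin g)" for b :: "'g extended" and n
    by (rule exI[of _ "b + Fin (- (\<Sum>_<n. g))"]) (cases b; simp add: nmult_Fin)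
  have sum_ge: "b \<le> scale n (\<Sum>i\<in>S. F i)" if "\<And>i. i \<in> S \<Longrightarrow> b \<le> scale n (F i)" for b S and n :: nat and F :: "nat \<Rightarrow> 'c"
    using that unshift[of b n] by (metis shift(1) semivaluation_sum_ge[OF sv])
  show ?thesis unfolding Vf_def[symmetric] Vh_def[symmetric]
  proof (rule antisym)
    show "Vf + Vh \<le> mono_val_poly v a (Fin g) (f * h)"
      unfolding mono_val_poly_ge_iff coeff scale_def[symmetric]
    proof (intro allI sum_ge)
      fix n i :: nat assume "i \<in> {..n}"
      then have "scale n (A i * B (n - i)) = (v (A i) + nmult i (Fin g)) + (v (B (n - i)) + nmult (n - i) (Fin g))"
        using prd[of i "n - i"] by (simp add: scale_def)
      then show "Vf + Vh \<le> scale n (A i * B (n - i))"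
        using extended_add_mono[OF leA leB] by simp
    qed
  next
    obtain i where i: "Vf = v (A i) + nmult i (Fin g)" "\<And>j. j < i \<Longrightarrow> Vf < v (A j) + nmult j (Fin g)"
      using mono_val_poly_least_index[of f a g] False unfolding Vf_def A_def by metis
    obtain k where k: "Vh = v (B k) + nmult k (Fin g)" "\<And>j. j < k \<Longrightarrow> Vh < v (B j) + nmult j (Fin g)"
      using mono_val_poly_least_index[of h a g] False unfolding Vh_def B_def by metis
    let ?n = "i + k"
    have main: "scale ?n (A i * B k) = Vf + Vh" using prd i(1) k(1) by (simp add: scale_def)
    \<comment> \<open>If \<open>j\<close> differs from \<open>i\<close>, then \<open>j < i\<close>
      or \<open>i + k - j < k\<close>; either way one of the two factors lies strictly above its
      minimum.\<close>
    have rest: "scale ?n (A j * B (?n - j)) > Vf + Vh" if "j \<le> ?n" "j \<noteq> i" for j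
    proof -
      have eq: "scale ?n (A j * B (?n - j)) = (v (A j) + nmult j (Fin g)) + (v (B (?n - j)) + nmult (?n - j) (Fin g))"
        using prd[of j "?n - j"] that by (simp add: scale_def)
      show ?thesis
      proof (cases "j < i")
        case True
        show ?thesis unfolding eq by (rule extended_add_less_le[OF i(2)[OF True] leB fin(4,2)])
      next
        case False
        then have "?n - j < k" using that by auto
        show ?thesis unfolding eq
          using extended_add_less_le[OF k(2)[OF \<open>?n - j < k\<close>] leA fin(3,1), of j] by (simp add: add.commute)
      qed
    qed
    have "v (A i * B k) < v (\<Sum>j\<in>{..?n} - {i}. A j * B (?n - j))"
    proof (rule semivaluation_sum_gt[OF sv])
      fix j assume "j \<in> {..?n} - {i}"
      then show "v (A i * B k) < v (A j * B (?n - j))"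
        using rest[of j] main by (simp add: shift(2)[of _ _ ?n] flip: scale_def)
    next
      have "scale ?n (A i * B k) \<noteq> Pinf" unfolding main using fin by (simp add: extended_add_eq_Pinf_iff)
      then have "v (A i * B k) \<noteq> Pinf" by (auto simp: scale_def)
      then show "v (A i * B k) < Pinf" by (simp add: less_le)
    qed
    from semivaluation_add_eq[OF sv this]
    have "v (coeff (pcompose (f * h) [:a, 1:]) ?n) = v (A i * B k)"
      unfolding coeff by (subst sum.remove[of _ i]) auto
    then show "mono_val_poly v a (Fin g) (f * h) \<le> Vf + Vh"
      using mono_val_poly_le_coeff[of a g "f * h" ?n] main by (simp add: scale_def)
  qed
qed

lemma semivaluation_mono_val_poly: "semivaluation (mono_val_poly v a (Fin g))"
  unfolding semivaluation_def
proof (intro conjI allI)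
  show "mono_val_poly v a (Fin g) 0 = Pinf" by (simp add: mono_val_poly_eq_Pinf_iff)
  show "mono_val_poly v a (Fin g) 1 = 0"
    using mono_val_poly_const[of a g 1] by (simp add: semivaluation_1[OF sv] one_pCons)
qed (simp_all only: mono_val_poly_mult mono_val_poly_add mono_val_poly_neq_Minf not_False_eq_True)

lemma mono_val_poly_linear: "mono_val_poly v a (Fin g) [:- c, 1:] = min (Fin g) (v (a - c))"
  by (simp add: mono_val_poly_def pcompose_pCons atMost_Suc semivaluation_1[OF sv])

text \<open>By Gauss' lemma the value is additive over linear factors, so it becomes a sum over
  roots of distances cut off at \<open>g\<close>. All later comparisons are made on such
  sums.\<close>

lemma mono_val_poly_prod_linear:
  "mono_val_poly v a (Fin g) (smult l (\<Prod>c\<in>#A. [:- c, 1:])) = v l + (\<Sum>c\<in>#A. min (Fin g) (v (a - c)))"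
proof -
  have "smult l (\<Prod>c\<in>#A. [:- c, 1:]) = [:l:] * (\<Prod>c\<in>#A. [:- c, 1:])" by simp
  then show ?thesis
    by (simp only: mono_val_poly_mult semivaluation_prod_mset[OF semivaluation_mono_val_poly]
        mono_val_poly_const mono_val_poly_linear)
qed

lemma semivaluation_eval: "semivaluation (\<lambda>f. v (poly f a))"
  using sv unfolding semivaluation_def by simp

end

section \<open>Factorization into linear factors and change of center\<close>

lemma alg_closed_roots:
  fixes f :: "'a::alg_closed_field poly"
  assumes "f \<noteq> 0"
  obtains A where "size A = degree f" "set_mset A = {x. poly f x = 0}"
    "f = smult (lead_coeff f) (\<Prod>x\<in>#A. [:- x, 1:])"
proof -
  obtain A where A: "size A = degree f" "f = smult (lead_coeff f) (\<Prod>x\<in>#A. [:- x, 1:])"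
    using alg_closed_imp_factorization[OF assms] by blast
  have "poly f x = lead_coeff f * (\<Prod>y\<in>#A. x - y)" for x
    by (subst A(2)) (simp add: poly_prod_mset)
  then have "set_mset A = {x. poly f x = 0}"
    using assms by (auto simp: prod_mset_zero_iff)
  with A that show ?thesis by blast
qed

text \<open>After factoring \<open>f\<close>, the center enters only through cut-off distances to
  the roots, and these do not change when it moves within the ball of radius
  \<open>g\<close>.\<close>

lemma mono_val_poly_center_cong:
  fixes v :: "'c::alg_closed_field \<Rightarrow> 'g::linordered_ab_group_add extended"
  assumes v: "valuation v" and "Fin g \<le> v (a - b)"
  shows "mono_val_poly v a (Fin g) f = mono_val_poly v b (Fin g) f"
proof (cases "f = 0")
  case False
  then obtain A where A: "f = smult (lead_coeff f) (\<Prod>x\<in>#A. [:- x, 1:])"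
    using alg_closed_roots by blast
  have "min (Fin g) (v (a - c)) = min (Fin g) (v (b - c))" for c
    by (rule semivaluation_min_cong[OF semivaluation_of_valuation[OF v]]) (use assms in simp)
  then have "mono_val_poly v a (Fin g) (smult (lead_coeff f) (\<Prod>x\<in>#A. [:- x, 1:]))
      = mono_val_poly v b (Fin g) (smult (lead_coeff f) (\<Prod>x\<in>#A. [:- x, 1:]))"
    by (simp add: mono_val_poly_prod_linear[OF v])
  then show ?thesis unfolding A[symmetric] .
next
  case True
  then show ?thesis using mono_val_poly_eq_Pinf_iff[OF v, of a g f] mono_val_poly_eq_Pinf_iff[OF v, of b g f] by simp
qed

section \<open>Roots and truncations\<close>

lemma semivaluation_Fract:
  assumes "valuation u"
  shows "semivaluation (\<lambda>f :: 'a::field poly. u (Fract f 1))"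
proof -
  have "Fract (f * g) 1 = Fract f 1 * Fract g 1" "Fract (f + g) 1 = Fract f 1 + Fract g 1" for f g :: "'a poly"
    by simp_all
  moreover have "Fract (0 :: 'a poly) 1 = 0" "Fract (1 :: 'a poly) 1 = 1"
    by (simp_all add: Zero_fract_def One_fract_def)
  ultimately show ?thesis
    using semivaluation_of_valuation[OF assms] unfolding semivaluation_def by metis
qed

lemma valuation_Fract_eq_Pinf_iff:
  assumes "valuation u"
  shows "u (Fract (f :: 'a::field poly) 1) = Pinf \<longleftrightarrow> f = 0"
  using valuation_eq_Pinf_iff[OF assms, of "Fract f 1"] by (simp add: Zero_fract_def eq_fract)

locale valued_extension =
  fixes \<iota> :: "'k::field \<Rightarrow> 'c::alg_closed_field"
    and vbar :: "'c \<Rightarrow> 'g::linordered_ab_group_add extended"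
    and w :: "'k poly fract \<Rightarrow> 'g extended"
    and wbar :: "'c poly fract \<Rightarrow> 'g extended"
  assumes closure: "algebraic_closure_of \<iota>"
    and vbar: "valuation vbar" and w: "valuation w" and wbar: "valuation wbar"
    and extends_w: "\<And>x. wbar (embed_ratfun \<iota> x) = w x"
    and extends_vbar: "\<And>z. wbar (Fract [:z:] 1) = vbar z"
begin

abbreviation E :: "'k poly \<Rightarrow> 'c poly" where "E \<equiv> map_poly \<iota>"
abbreviation wp :: "'k poly \<Rightarrow> 'g extended" where "wp f \<equiv> w (Fract f 1)"
abbreviation W :: "'c poly \<Rightarrow> 'g extended" where "W f \<equiv> wbar (Fract f 1)"
abbreviation V :: "'c \<Rightarrow> 'g extended \<Rightarrow> 'k poly \<Rightarrow> 'g extended" where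
  "V a d f \<equiv> mono_val_poly vbar a d (E f)"
abbreviation \<delta> :: "'k poly \<Rightarrow> 'g extended" where "\<delta> \<equiv> delta \<iota> wbar"

section \<open>The embedding of K[X] and the valuations restricted to it\<close>

lemma \<iota>_add: "\<iota> (x + y) = \<iota> x + \<iota> y" and \<iota>_mult: "\<iota> (x * y) = \<iota> x * \<iota> y" and \<iota>_1: "\<iota> 1 = 1"
  using closure by (auto simp: algebraic_closure_of_def)

lemma \<iota>_0: "\<iota> 0 = 0"
  using \<iota>_add[of 0 0] by (metis add_0 add_cancel_left_right)

lemma \<iota>_eq_0_iff: "\<iota> x = 0 \<longleftrightarrow> x = 0"
  using \<iota>_mult[of x "inverse x"] \<iota>_0 \<iota>_1 by (cases "x = 0") auto

lemma \<iota>_sum: "\<iota> (sum f A) = (\<Sum>x\<in>A. \<iota> (f x))"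
  by (induction A rule: infinite_finite_induct) (auto simp: \<iota>_0 \<iota>_add)

lemma E_add: "E (f + g) = E f + E g"
  by (rule poly_eqI) (simp add: coeff_map_poly \<iota>_0 \<iota>_add)

lemma E_mult: "E (f * g) = E f * E g"
  by (rule poly_eqI) (simp add: coeff_map_poly \<iota>_0 coeff_mult \<iota>_sum \<iota>_mult)

lemma E_1: "E 1 = 1"
  by (simp add: \<iota>_1)

lemma E_eq_0_iff: "E f = 0 \<longleftrightarrow> f = 0"
  by (simp add: poly_eq_iff coeff_map_poly \<iota>_0 \<iota>_eq_0_iff)

lemma degree_E: "degree (E f) = degree f"
  by (rule degree_map_poly) (simp add: \<iota>_eq_0_iff)

lemma semivaluation_vbar: "semivaluation vbar"
  by (rule semivaluation_of_valuation[OF vbar])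

lemma semivaluation_wp: "semivaluation wp"
  by (rule semivaluation_Fract[OF w])

lemma semivaluation_W: "semivaluation W"
  by (rule semivaluation_Fract[OF wbar])

lemma semivaluation_comp_E:
  assumes "semivaluation u"
  shows "semivaluation (\<lambda>f. u (E f))"
  using assms unfolding semivaluation_def by (simp add: E_add E_mult E_1)

lemma semivaluation_V: "semivaluation (V a (Fin g))"
  by (rule semivaluation_comp_E[OF semivaluation_mono_val_poly[OF vbar]])

lemma semivaluation_eval_E: "semivaluation (\<lambda>f. vbar (poly (E f) a))"
  by (rule semivaluation_comp_E[OF semivaluation_eval[OF vbar]])

lemma wp_eq_Pinf_iff: "wp f = Pinf \<longleftrightarrow> f = 0"
  by (rule valuation_Fract_eq_Pinf_iff[OF w])

lemma wp_finite: "f \<noteq> 0 \<Longrightarrow> \<exists>g. wp f = Fin g"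
  using wp_eq_Pinf_iff[of f] semivaluation_neq_Minf[OF semivaluation_wp, of f] by (cases "wp f") auto

lemma W_E: "W (E f) = wp f"
  using extends_w[of "Fract f 1"] by (simp add: embed_ratfun_Fract[OF closure] \<iota>_1)

lemma W_linear_finite: "\<exists>g. W [:- a, 1:] = Fin g"
  using valuation_Fract_eq_Pinf_iff[OF wbar, of "[:- a, 1:]"]
    semivaluation_neq_Minf[OF semivaluation_W, of "[:- a, 1:]"]
  by (cases "W [:- a, 1:]") auto

text \<open>X - x and a - x differ by X - a, which has value at least \<open>g\<close>; up to the
  cutoff, X behaves like the point \<open>a\<close>.\<close>

lemma min_vbar_eq_min_W:
  assumes "g \<le> W [:- a, 1:]"
  shows "min g (vbar (a - x)) = min g (W [:- x, 1:])"
proof -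
  have "min g (W [:- x, 1:]) = min g (W [:a - x:])"
    by (rule semivaluation_min_cong[OF semivaluation_W]) (use assms in simp)
  then show ?thesis by (simp add: extends_vbar)
qed

lemma vbar_diff_ge:
  assumes "g \<le> W [:- a, 1:]" "g \<le> W [:- b, 1:]"
  shows "g \<le> vbar (a - b)"
  using min_vbar_eq_min_W[OF assms(1), of b] assms(2) by (simp add: min.absorb1 min_def split: if_splits)

section \<open>Values as sums over roots\<close>

lemma roots_E:
  assumes "f \<noteq> 0"
  obtains A where "size A = degree f" "set_mset A = {x. poly (E f) x = 0}"
    "E f = smult (\<iota> (lead_coeff f)) (\<Prod>x\<in>#A. [:- x, 1:])"
proof -
  have "E f \<noteq> 0" using assms by (simp add: E_eq_0_iff)
  from alg_closed_roots[OF this] that show ?thesis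
    by (metis degree_E coeff_map_poly \<iota>_0)
qed

lemma V_prod:
  assumes "E f = smult l (\<Prod>x\<in>#A. [:- x, 1:])"
  shows "V a (Fin g) f = vbar l + (\<Sum>x\<in>#A. min (Fin g) (vbar (a - x)))"
  unfolding assms by (rule mono_val_poly_prod_linear[OF vbar])

lemma wp_prod:
  assumes "E f = smult l (\<Prod>x\<in>#A. [:- x, 1:])"
  shows "wp f = vbar l + (\<Sum>x\<in>#A. W [:- x, 1:])"
proof -
  have "smult l (\<Prod>x\<in>#A. [:- x, 1:]) = [:l:] * (\<Prod>x\<in>#A. [:- x, 1:])" by simp
  then show ?thesis unfolding W_E[symmetric] assms
    by (simp only: semivaluation_mult[OF semivaluation_W] semivaluation_prod_mset[OF semivaluation_W] extends_vbar)
qed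

lemma vbar_eval_prod:
  assumes "E f = smult l (\<Prod>x\<in>#A. [:- x, 1:])"
  shows "vbar (poly (E f) a) = vbar l + (\<Sum>x\<in>#A. vbar (a - x))"
  unfolding assms
  by (simp add: poly_prod_mset semivaluation_mult[OF semivaluation_vbar]
      semivaluation_prod_mset[OF semivaluation_vbar])

lemma V_center_cong:
  "Fin g \<le> vbar (a - b) \<Longrightarrow> V a (Fin g) f = V b (Fin g) f"
  by (rule mono_val_poly_center_cong[OF vbar])

lemma V_le_eval: "V a (Fin g) f \<le> vbar (poly (E f) a)"
  by (rule mono_val_poly_le_eval[OF vbar])

lemma V_eq_Pinf_iff: "V a (Fin g) f = Pinf \<longleftrightarrow> f = 0"
  by (simp add: mono_val_poly_eq_Pinf_iff[OF vbar] E_eq_0_iff)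

lemma V_mono: "g \<le> g' \<Longrightarrow> V a (Fin g) f \<le> V a (Fin g') f"
  by (rule mono_val_poly_mono[OF vbar])

section \<open>The invariant \<open>\<delta>\<close> and the comparison of \<open>V\<close> with
  \<open>w\<close>\<close>

lemma delta_set:
  assumes "degree f > 0"
  shows "finite {W [:- z, 1:] | z. poly (E f) z = 0}" "{W [:- z, 1:] | z. poly (E f) z = 0} \<noteq> {}"
proof -
  have "E f \<noteq> 0" using assms by (auto simp: E_eq_0_iff)
  then show "finite {W [:- z, 1:] | z. poly (E f) z = 0}"
    by (simp add: poly_roots_finite setcompr_eq_image)
  show "{W [:- z, 1:] | z. poly (E f) z = 0} \<noteq> {}"
    using alg_closed_imp_poly_has_root[of "E f"] assms by (auto simp: degree_E)
qed

lemma delta_ge: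
  assumes "f \<noteq> 0" "poly (E f) z = 0"
  shows "W [:- z, 1:] \<le> \<delta> f"
proof -
  have "degree f > 0"
  proof (rule ccontr)
    assume "\<not> ?thesis"
    then obtain c where "f = [:c:]" by (auto elim: degree_eq_zeroE)
    with assms show False by (simp add: map_poly_pCons \<iota>_0 \<iota>_eq_0_iff)
  qed
  then show ?thesis
    using Max_ge[OF delta_set(1)[of f], of "W [:- z, 1:]"] assms(2) unfolding delta_def by auto
qed

lemma delta_attained:
  assumes "degree f > 0"
  obtains z where "poly (E f) z = 0" "W [:- z, 1:] = \<delta> f"
  using Max_in[OF delta_set[OF assms]] assms that unfolding delta_def by auto

lemma delta_finite: "degree f > 0 \<Longrightarrow> \<exists>g. \<delta> f = Fin g"
  by (metis delta_attained W_linear_finite)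

text \<open>By \<open>min_vbar_eq_min_W\<close>, \<open>V\<close> gives each factor X - x its value
  under \<open>W\<close> cut off at \<open>g\<close>, so the sums compare termwise. When
  \<open>\<delta> f \<le> Fin g\<close> the cutoff affects no factor, which gives
  \<open>V_eq_wp\<close>.\<close>

lemma V_le_wp:
  assumes "W [:- a, 1:] = Fin g"
  shows "V a (Fin g) f \<le> wp f"
proof (cases "f = 0")
  case False
  then obtain A where A: "E f = smult (\<iota> (lead_coeff f)) (\<Prod>x\<in>#A. [:- x, 1:])"
    using roots_E by blast
  show ?thesis unfolding V_prod[OF A] wp_prod[OF A]
    by (intro add_left_mono sum_mset_le) (use assms min_vbar_eq_min_W in simp)
qed (simp add: semivaluation_0[OF semivaluation_wp])

lemma V_eq_wp:
  assumes "W [:- a, 1:] = Fin g" "\<delta> f \<le> Fin g"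
  shows "V a (Fin g) f = wp f"
proof (cases "f = 0")
  case False
  then obtain A where A: "set_mset A = {x. poly (E f) x = 0}"
    "E f = smult (\<iota> (lead_coeff f)) (\<Prod>x\<in>#A. [:- x, 1:])"
    using roots_E by blast
  have "min (Fin g) (vbar (a - x)) = W [:- x, 1:]" if "x \<in># A" for x
    using delta_ge[OF False, of x] that assms(2) A(1) min_vbar_eq_min_W[of "Fin g" a x] assms(1)
    by (auto simp: min_def)
  then show ?thesis unfolding V_prod[OF A(2)] wp_prod[OF A(2)] by (simp cong: sum_mset_cong')
qed (simp add: semivaluation_0[OF semivaluation_wp] semivaluation_0[OF semivaluation_V, simplified])

text \<open>The cutoff strictly lowers the factor of a root attaining \<open>\<delta> f\<close>, and
  all summands are finite.\<close>

lemma V_less_wp: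
  assumes "W [:- a, 1:] = Fin g" "Fin g < \<delta> f" "degree f > 0"
  shows "V a (Fin g) f < wp f"
proof -
  have f: "f \<noteq> 0" using assms(3) by auto
  then obtain A where A: "set_mset A = {x. poly (E f) x = 0}"
    "E f = smult (\<iota> (lead_coeff f)) (\<Prod>x\<in>#A. [:- x, 1:])"
    using roots_E by blast
  obtain z where z: "poly (E f) z = 0" "W [:- z, 1:] = \<delta> f" using delta_attained[OF assms(3)] .
  have eq: "min (Fin g) (vbar (a - x)) = min (Fin g) (W [:- x, 1:])" for x
    using min_vbar_eq_min_W[of "Fin g" a x] assms(1) by simp
  have fin: "min (Fin g) (W [:- x, 1:]) \<noteq> Minf" "min (Fin g) (W [:- x, 1:]) \<noteq> Pinf" for x
    using W_linear_finite[of x] by auto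
  have zA: "z \<in># A" using A(1) z(1) by simp
  have "min (Fin g) (W [:- z, 1:]) < W [:- z, 1:]" using z(2) assms(2) by (simp add: min_def)
  with zA have "(\<Sum>x\<in>#A. min (Fin g) (vbar (a - x))) < (\<Sum>x\<in>#A. W [:- x, 1:])"
    unfolding eq by (intro sum_mset_less[of _ _ _ z] fin) simp_all
  moreover have "vbar (\<iota> (lead_coeff f)) \<noteq> Minf" "vbar (\<iota> (lead_coeff f)) \<noteq> Pinf"
    using f by (simp_all add: semivaluation_neq_Minf[OF semivaluation_vbar] valuation_eq_Pinf_iff[OF vbar] \<iota>_eq_0_iff)
  ultimately show ?thesis unfolding V_prod[OF A(2)] wp_prod[OF A(2)]
    by (metis add.commute extended_add_less_le order_refl)
qed

section \<open>Truncations computed by \<open>V\<close> at a root\<close>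

lemma trunc_poly_ge_iff:
  assumes "degree Q > 0"
  shows "b \<le> trunc_poly w Q f \<longleftrightarrow> (\<forall>t. b \<le> wp (coeff (q_expansion Q f) t) + nmult t (wp Q))"
proof -
  let ?c = "q_expansion Q f"
  have eq: "wp (coeff ?c t * Q ^ t) = wp (coeff ?c t) + nmult t (wp Q)" for t
    using semivaluation_mult[OF semivaluation_wp] semivaluation_power[OF semivaluation_wp] by metis
  have "wp (coeff ?c t) + nmult t (wp Q) = Pinf" if "t > degree ?c" for t
    using that by (simp add: coeff_eq_0 semivaluation_0[OF semivaluation_wp])
  then show ?thesis
    unfolding trunc_poly_def Min_image_ge_iff eq by (metis le_Pinf not_le_imp_less)
qed

text \<open>Evaluating at \<open>a\<close> kills \<open>Q * h\<close>, so the value of \<open>c + Q * h\<close> cannot exceed that of \<open>c\<close>.\<close>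

lemma V_expansion_step:
  assumes root: "poly (E Q) a = 0"
    and c: "vbar (poly (E c) a) = wp c" "wp c \<le> V a (Fin g) c"
  shows "V a (Fin g) (c + Q * h) = min (wp c) (V a (Fin g) (Q * h))"
proof (rule antisym)
  have 1: "V a (Fin g) (c + Q * h) \<le> wp c"
    using V_le_eval[of a g "c + Q * h"] root c(1) by (simp add: E_add E_mult)
  then have "V a (Fin g) (c + Q * h) \<le> V a (Fin g) (Q * h)"
    using semivaluation_diff_ge[OF semivaluation_V, of "V a (Fin g) (c + Q * h)" a g "c + Q * h" c] c(2) by simp
  with 1 show "V a (Fin g) (c + Q * h) \<le> min (wp c) (V a (Fin g) (Q * h))" by simp
  show "min (wp c) (V a (Fin g) (Q * h)) \<le> V a (Fin g) (c + Q * h)"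
    by (rule semivaluation_add_ge[OF semivaluation_V]) (use c(2) in \<open>auto simp: min.coboundedI1\<close>)
qed

text \<open>Induction on the \<open>Q\<close>-expansion: \<open>V_expansion_step\<close> peels off
  one coefficient and multiplicativity removes one factor \<open>Q\<close>. Comparing all lower
  bounds \<open>b\<close> instead of minima turns the removed factor into a shift of
  \<open>b\<close>.\<close>

lemma V_eq_trunc_poly:
  assumes Q: "degree Q > 0" and root: "poly (E Q) a = 0"
    and small: "\<And>h. degree h < degree Q \<Longrightarrow> vbar (poly (E h) a) = wp h"
      "\<And>h. degree h < degree Q \<Longrightarrow> wp h \<le> V a (Fin g) h"
    and VQ: "V a (Fin g) Q = wp Q"
  shows "V a (Fin g) f = trunc_poly w Q f"
proof -
  have "Q \<noteq> 0" using Q by auto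
  then obtain q where q: "wp Q = Fin q" using wp_finite by blast
  have all_nat: "(\<forall>t. P t) \<longleftrightarrow> P 0 \<and> (\<forall>t. P (Suc t))" for P :: "nat \<Rightarrow> bool"
    by (metis not0_implies_Suc)
  have ge: "b \<le> V a (Fin g) (poly c Q) \<longleftrightarrow> (\<forall>t. b \<le> wp (coeff c t) + nmult t (wp Q))"
    if "\<forall>t. degree (coeff c t) < degree Q" for c b
    using that
  proof (induction c arbitrary: b)
    case 0
    then show ?case
      using semivaluation_0[OF semivaluation_V, of a g] by (simp add: semivaluation_0[OF semivaluation_wp])
  next
    case (pCons c0 c)
    have c0: "degree c0 < degree Q" using pCons.prems by (metis coeff_pCons_0)
    have c: "\<forall>t. degree (coeff c t) < degree Q" using pCons.prems by (metis coeff_pCons_Suc)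
    have shift: "b \<le> Fin q + x \<longleftrightarrow> b + Fin (- q) \<le> x" for x
      by (cases b; cases x) (auto simp: algebra_simps)
    have "b \<le> V a (Fin g) (poly (pCons c0 c) Q) \<longleftrightarrow> b \<le> wp c0 \<and> b \<le> Fin q + V a (Fin g) (poly c Q)"
      using V_expansion_step[OF root small(1)[OF c0] small(2)[OF c0], of "poly c Q"]
        semivaluation_mult[OF semivaluation_V, of a g Q "poly c Q"] VQ q by simp
    also have "\<dots> \<longleftrightarrow> b \<le> wp c0 \<and> (\<forall>t. b \<le> wp (coeff c t) + nmult (Suc t) (wp Q))"
      unfolding shift pCons.IH[OF c]
      by (simp add: shift[symmetric] nmult_Suc q add_ac)
    also have "\<dots> \<longleftrightarrow> (\<forall>t. b \<le> wp (coeff (pCons c0 c) t) + nmult t (wp Q))"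
      unfolding all_nat[of "\<lambda>t. b \<le> wp (coeff (pCons c0 c) t) + nmult t (wp Q)"] by simp
    finally show ?case .
  qed
  have "b \<le> V a (Fin g) f \<longleftrightarrow> b \<le> trunc_poly w Q f" for b
    using ge[of "q_expansion Q f" b] q_expansion[OF Q, of f] trunc_poly_ge_iff[OF Q, of b f] by simp
  then show ?thesis by (meson antisym order_refl)
qed

section \<open>Truncations at key polynomials\<close>

abbreviation key :: "'k poly \<Rightarrow> bool" where "key \<equiv> key_polynomial \<iota> wbar"

lemma key_lead_coeff: "key Q \<Longrightarrow> lead_coeff Q = 1"
  and key_degree: "key Q \<Longrightarrow> degree Q > 0"
  and key_delta_less: "key Q \<Longrightarrow> f \<noteq> 0 \<Longrightarrow> degree f < degree Q \<Longrightarrow> \<delta> f < \<delta> Q"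
  by (simp_all add: key_polynomial_def)

text \<open>If X is closer to \<open>a\<close> than to any root x of \<open>f\<close>, then X - x
  and a - x have the same value.\<close>

lemma vbar_eval_eq_wp:
  assumes "f \<noteq> 0" "\<delta> f < W [:- a, 1:]"
  shows "vbar (poly (E f) a) = wp f"
proof -
  obtain A where A: "set_mset A = {x. poly (E f) x = 0}"
    "E f = smult (\<iota> (lead_coeff f)) (\<Prod>x\<in>#A. [:- x, 1:])"
    using roots_E[OF assms(1)] by blast
  have "vbar (a - x) = W [:- x, 1:]" if "x \<in># A" for x
  proof -
    have "W [:- x, 1:] < W (- [:- a, 1:])"
      using delta_ge[OF assms(1), of x] that A(1) assms(2)
      unfolding semivaluation_minus[OF semivaluation_W] by auto
    from semivaluation_add_eq[OF semivaluation_W this]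
    show ?thesis by (simp add: extends_vbar)
  qed
  then show ?thesis unfolding vbar_eval_prod[OF A(2)] wp_prod[OF A(2)] by (simp cong: sum_mset_cong')
qed

text \<open>Polynomials of smaller degree have smaller \<open>\<delta>\<close>, so
  \<open>vbar_eval_eq_wp\<close> and \<open>V_eq_wp\<close> apply to them at \<open>a\<close> and
  supply the hypotheses of \<open>V_eq_trunc_poly\<close>.\<close>

lemma key_trunc_poly:
  assumes "key Q" "poly (E Q) a = 0" "W [:- a, 1:] = \<delta> Q"
  shows "trunc_poly w Q f = V a (\<delta> Q) f"
proof -
  obtain g where g: "\<delta> Q = Fin g" using delta_finite[OF key_degree[OF assms(1)]] by blast
  have small: "vbar (poly (E h) a) = wp h \<and> wp h \<le> V a (Fin g) h" if "degree h < degree Q" for h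
  proof (cases "h = 0")
    case True
    then show ?thesis
      using semivaluation_0[OF semivaluation_wp] semivaluation_0[OF semivaluation_V, of a g]
      by (simp add: semivaluation_0[OF semivaluation_vbar])
  next
    case False
    then show ?thesis
      using vbar_eval_eq_wp[OF False] V_eq_wp[of a g h] key_delta_less[OF assms(1) False that] assms(3) g by simp
  qed
  show ?thesis unfolding g
    by (rule V_eq_trunc_poly[OF key_degree[OF assms(1)] assms(2), symmetric])
       (use small V_eq_wp[of a g Q] assms(3) g in auto)
qed

lemma key_trunc_poly':
  assumes "key Q"
  obtains a g where "poly (E Q) a = 0" "W [:- a, 1:] = Fin g" "\<delta> Q = Fin g"
    "\<And>f. trunc_poly w Q f = V a (Fin g) f"
proof -
  obtain a where a: "poly (E Q) a = 0" "W [:- a, 1:] = \<delta> Q"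
    using delta_attained[OF key_degree[OF assms]] by blast
  obtain g where "\<delta> Q = Fin g" using delta_finite[OF key_degree[OF assms]] by blast
  with a key_trunc_poly[OF assms a] that show ?thesis by metis
qed

text \<open>Multiplicativity is hard to see from \<open>Q\<close>-expansions; it is inherited from
  \<open>V\<close> at a root attaining \<open>\<delta> Q\<close>.\<close>

lemma semivaluation_trunc_poly: "key Q \<Longrightarrow> semivaluation (trunc_poly w Q)"
  using key_trunc_poly'[of Q] semivaluation_V unfolding semivaluation_def by (smt (verit))

lemma trunc_poly_eq_Pinf_iff: "key Q \<Longrightarrow> trunc_poly w Q f = Pinf \<longleftrightarrow> f = 0"
  by (metis key_trunc_poly' V_eq_Pinf_iff)

lemma trunc_poly_le_wp: "key Q \<Longrightarrow> trunc_poly w Q f \<le> wp f"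
  by (metis key_trunc_poly' V_le_wp)

lemma trunc_poly_eq_wp: "key Q \<Longrightarrow> \<delta> f \<le> \<delta> Q \<Longrightarrow> trunc_poly w Q f = wp f"
  by (metis key_trunc_poly' V_eq_wp)

lemma trunc_poly_less_wp: "key Q \<Longrightarrow> degree f > 0 \<Longrightarrow> \<delta> Q < \<delta> f \<Longrightarrow> trunc_poly w Q f < wp f"
  by (metis key_trunc_poly' V_less_wp)

section \<open>Key polynomials all of whose roots define the truncation\<close>

text \<open>The coefficients of the expansion of \<open>f\<close> at \<open>b\<close> are, as functions of \<open>b\<close>, polynomials over
  \<open>K\<close> (the Hasse derivatives of \<open>f\<close>).\<close>

lemma hasse_derivative_exists:
  "\<exists>h. (h = 0 \<or> degree h + l \<le> degree f) \<and> (\<forall>b. poly (E h) b = coeff (pcompose (E f) [:b, 1:]) l)"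
proof (induction f arbitrary: l)
  case 0
  show ?case by (intro exI[of _ 0]) simp
next
  case (pCons c p)
  have E: "E (pCons c p) = pCons (\<iota> c) (E p)" by (simp add: map_poly_pCons \<iota>_0)
  show ?case
  proof (cases l)
    case 0
    then show ?thesis by (intro exI[of _ "pCons c p"]) simp
  next
    case (Suc m)
    show ?thesis
    proof (cases "p = 0")
      case True
      then show ?thesis by (intro exI[of _ 0]) (simp add: map_poly_pCons \<iota>_0 Suc pcompose_pCons)
    next
      case False
      obtain h1 where h1: "h1 = 0 \<or> degree h1 + Suc m \<le> degree p"
        "\<And>b. poly (E h1) b = coeff (pcompose (E p) [:b, 1:]) (Suc m)" using pCons.IH by blast
      obtain h2 where h2: "h2 = 0 \<or> degree h2 + m \<le> degree p"
        "\<And>b. poly (E h2) b = coeff (pcompose (E p) [:b, 1:]) m" using pCons.IH by blast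
      \<comment> \<open>Writing X = b + (X - b), the coefficient of index \<open>Suc m\<close> of X
        * p at \<open>b\<close> is \<open>b\<close> times that of \<open>p\<close>, plus the
        coefficient of \<open>p\<close> of index \<open>m\<close>. As functions of \<open>b\<close>
        these are \<open>pCons 0 h1\<close> and \<open>h2\<close>.\<close>
      define h where "h = pCons 0 h1 + h2"
      have "poly (E h) b = coeff (pcompose (E (pCons c p)) [:b, 1:]) l" for b
        by (simp add: h_def E_add map_poly_pCons \<iota>_0 h1 h2 Suc pcompose_pCons)
      moreover have "h = 0 \<or> degree h + l \<le> degree (pCons c p)"
      proof (cases "h1 = 0")
        case True
        then show ?thesis using h2(1) False Suc by (auto simp: h_def)
      next
        case h1_nz: False
        show ?thesis
        proof (cases "h2 = 0")
          case True
          then show ?thesis using h1(1) h1_nz False Suc by (auto simp: h_def)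
        next
          case h2_nz: False
          have "degree h \<le> max (degree (pCons 0 h1)) (degree h2)"
            unfolding h_def by (rule degree_add_le_max)
          then show ?thesis using h1(1) h2(1) h1_nz h2_nz False Suc by auto
        qed
      qed
      ultimately show ?thesis by blast
    qed
  qed
qed

lemma hasse_derivative:
  assumes "degree f > 0" "l > 0"
  obtains h where "degree h < degree f" "\<And>b. poly (E h) b = coeff (pcompose (E f) [:b, 1:]) l"
proof -
  obtain h where "h = 0 \<or> degree h + l \<le> degree f" "\<And>b. poly (E h) b = coeff (pcompose (E f) [:b, 1:]) l"
    using hasse_derivative_exists[of l f] by blast
  with assms that[of h] show ?thesis by auto
qed

text \<open>The Taylor coefficients of \<open>Q\<close> at a root \<open>a\<close> are values at \<open>a\<close> of polynomials of smaller degree.\<close>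

lemma V_eq_if_small_eval_eq:
  assumes "degree Q > 0" "poly (E Q) a = 0" "poly (E Q) b = 0"
    and eq: "\<And>h. degree h < degree Q \<Longrightarrow> vbar (poly (E h) a) = vbar (poly (E h) b)"
  shows "V a d Q = V b d Q"
proof -
  have "vbar (coeff (pcompose (E Q) [:a, 1:]) i) = vbar (coeff (pcompose (E Q) [:b, 1:]) i)" for i
  proof (cases "i = 0")
    case False
    then show ?thesis using hasse_derivative[OF assms(1), of i] eq by (metis neq0_conv)
  qed (use assms in simp)
  then show ?thesis unfolding mono_val_poly_def by simp
qed

lemma key_small_eval:
  assumes "key Q" "W [:- a, 1:] = \<delta> Q" "degree h < degree Q"
  shows "vbar (poly (E h) a) = wp h"
proof (cases "h = 0")
  case False
  then show ?thesis using vbar_eval_eq_wp[OF False] key_delta_less[OF assms(1) False assms(3)] assms(2) by simp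
qed (simp add: semivaluation_0[OF semivaluation_wp] semivaluation_0[OF semivaluation_vbar])

lemma trunc_poly_small:
  assumes "key Q" "degree h < degree Q"
  shows "trunc_poly w Q h = wp h"
proof (cases "h = 0")
  case True
  then show ?thesis
    using semivaluation_0[OF semivaluation_trunc_poly[OF assms(1)]] by (simp add: semivaluation_0[OF semivaluation_wp])
next
  case False
  show ?thesis
    by (rule trunc_poly_eq_wp[OF assms(1)]) (use key_delta_less[OF assms(1) False assms(2)] in simp)
qed

text \<open>What \<open>V_eq_trunc_poly\<close> still requires is the value of \<open>Q\<close>
  itself. It is transferred from a root \<open>b\<close> attaining \<open>\<delta> Q\<close>: by the
  small-degree hypothesis, the Taylor coefficients of \<open>Q\<close> at \<open>a\<close> and at
  \<open>b\<close> have equal values.\<close>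

lemma key_root_V_eq_trunc_poly:
  assumes "key Q" "poly (E Q) a = 0"
    and small: "\<And>h. degree h < degree Q \<Longrightarrow> vbar (poly (E h) a) = wp h"
      "\<And>h. degree h < degree Q \<Longrightarrow> wp h \<le> V a (\<delta> Q) h"
  shows "V a (\<delta> Q) f = trunc_poly w Q f"
proof -
  obtain b where b: "poly (E Q) b = 0" "W [:- b, 1:] = \<delta> Q"
    using delta_attained[OF key_degree[OF assms(1)]] by blast
  obtain g where g: "\<delta> Q = Fin g" using delta_finite[OF key_degree[OF assms(1)]] by blast
  have "V a (Fin g) Q = V b (Fin g) Q"
    by (rule V_eq_if_small_eval_eq[OF key_degree[OF assms(1)] assms(2) b(1)])
       (simp add: small(1) key_small_eval[OF assms(1) b(2)])
  also have "\<dots> = wp Q" by (rule V_eq_wp) (use b g in simp_all)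
  finally show ?thesis
    unfolding g by (intro V_eq_trunc_poly[OF key_degree[OF assms(1)] assms(2)]) (use small g in auto)
qed

text \<open>Condition (ii) for a single key polynomial, stated on K[X];
  \<open>root_uniform_iff_fract\<close> extends it to K(X).\<close>

definition root_uniform :: "'k poly \<Rightarrow> bool" where
  "root_uniform Q \<longleftrightarrow> (\<forall>a. poly (E Q) a = 0 \<longrightarrow> (\<forall>f. V a (\<delta> Q) f = trunc_poly w Q f))"

text \<open>Replacing \<open>a\<close> by a root \<open>b\<close> of \<open>Q\<close> closest to it can only increase the distances
  to the other roots, and strictly increases the distance to \<open>b\<close>.\<close>

lemma eval_less_if_far:
  assumes Q: "key Q" "root_uniform Q"
    and far: "\<And>b. poly (E Q) b = 0 \<Longrightarrow> vbar (a - b) < \<delta> Q"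
  shows "vbar (poly (E Q) a) < wp Q"
proof -
  have nz: "Q \<noteq> 0" using key_degree[OF Q(1)] by auto
  then obtain A where A: "size A = degree Q" "set_mset A = {x. poly (E Q) x = 0}"
    "E Q = smult (\<iota> (lead_coeff Q)) (\<Prod>x\<in>#A. [:- x, 1:])"
    using roots_E by blast
  obtain g where g: "\<delta> Q = Fin g" using delta_finite[OF key_degree[OF Q(1)]] by blast
  have "set_mset A \<noteq> {}" using A(1) key_degree[OF Q(1)] by auto
  define m where "m = Max ((\<lambda>b. vbar (a - b)) ` set_mset A)"
  have "m \<in> (\<lambda>b. vbar (a - b)) ` set_mset A"
    unfolding m_def by (rule Max_in) (use \<open>set_mset A \<noteq> {}\<close> in auto)
  then obtain b where b: "b \<in># A" "m = vbar (a - b)" by auto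
  have bmax: "vbar (a - c) \<le> vbar (a - b)" if "c \<in># A" for c
    unfolding b(2)[symmetric] m_def by (rule Max_ge) (use that in auto)
  have far': "vbar (a - c) < Fin g" if "c \<in># A" for c using far[of c] that A(2) g by simp
  have fin: "vbar (a - c) \<noteq> Minf" "vbar (a - c) \<noteq> Pinf" if "c \<in># A" for c
    using far'[OF that] semivaluation_neq_Minf[OF semivaluation_vbar] by auto
  have "vbar (a - c) \<le> min (Fin g) (vbar (b - c))" if "c \<in># A" for c
    using semivaluation_diff_ge[OF semivaluation_vbar, of "vbar (a - c)" "a - c" "a - b"]
      bmax[OF that] far'[OF that] by simp
  moreover have "vbar (a - b) < min (Fin g) (vbar (b - b))"
    using far'[OF b(1)] by (simp add: semivaluation_0[OF semivaluation_vbar])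
  ultimately have "(\<Sum>c\<in>#A. vbar (a - c)) < (\<Sum>c\<in>#A. min (Fin g) (vbar (b - c)))"
    using b(1) fin by (intro sum_mset_less[of _ _ _ b]) simp_all
  \<comment> \<open>Since \<open>b\<close> is itself a root of \<open>Q\<close>, uniformity
    identifies the larger sum with \<open>wp Q\<close>.\<close>
  moreover have "V b (Fin g) Q = wp Q"
  proof -
    have "V b (\<delta> Q) Q = trunc_poly w Q Q" using Q(2) b(1) A(2) unfolding root_uniform_def by auto
    then show ?thesis using trunc_poly_eq_wp[OF Q(1), of Q] g by simp
  qed
  moreover have "vbar (\<iota> (lead_coeff Q)) = 0"
    by (simp add: key_lead_coeff[OF Q(1)] \<iota>_1 semivaluation_1[OF semivaluation_vbar])
  ultimately show ?thesis
    using V_prod[OF A(3), of b g] vbar_eval_prod[OF A(3), of a] by simp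
qed

text \<open>If \<open>a\<close> is close to a root of \<open>Q\<close>, the center can be moved to
  that root; otherwise \<open>eval_less_if_far\<close> applies.\<close>

lemma V_eq_trunc_poly_or_eval_less:
  assumes Q: "key Q" "root_uniform Q"
  shows "(\<forall>f. V a (\<delta> Q) f = trunc_poly w Q f) \<or> vbar (poly (E Q) a) < wp Q"
proof (rule disjCI)
  assume "\<not> vbar (poly (E Q) a) < wp Q"
  then obtain b where b: "poly (E Q) b = 0" "\<delta> Q \<le> vbar (a - b)"
    using eval_less_if_far[OF Q, of a] by (meson not_le)
  obtain g where g: "\<delta> Q = Fin g" using delta_finite[OF key_degree[OF Q(1)]] by blast
  show "\<forall>f. V a (\<delta> Q) f = trunc_poly w Q f"
    using V_center_cong[of g a b] b Q(2) unfolding root_uniform_def g by auto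
qed

lemma V_key_le_wp:
  assumes Q: "key Q" "root_uniform Q"
  shows "V a (\<delta> Q) Q \<le> wp Q"
proof -
  obtain g where g: "\<delta> Q = Fin g" using delta_finite[OF key_degree[OF Q(1)]] by blast
  show ?thesis
    using V_eq_trunc_poly_or_eval_less[OF Q, of a] trunc_poly_eq_wp[OF Q(1), of Q] V_le_eval[of a g Q]
    unfolding g by (auto intro: order.trans)
qed

section \<open>Double counting over pairs of roots\<close>

lemma double_root_sum:
  assumes Q: "key Q" "root_uniform Q" and f: "lead_coeff f = 1"
    and A: "E f = smult (\<iota> (lead_coeff f)) (\<Prod>x\<in>#A. [:- x, 1:])"
  shows "nmult (degree Q) (trunc_poly w Q f) = (\<Sum>a\<in>#A. V a (\<delta> Q) Q)"
proof -
  have nz: "Q \<noteq> 0" using key_degree[OF Q(1)] by auto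
  then obtain B where B: "size B = degree Q" "set_mset B = {x. poly (E Q) x = 0}"
    "E Q = smult (\<iota> (lead_coeff Q)) (\<Prod>x\<in>#B. [:- x, 1:])"
    using roots_E by blast
  obtain g where g: "\<delta> Q = Fin g" using delta_finite[OF key_degree[OF Q(1)]] by blast
  have one: "vbar (\<iota> 1) = 0" by (simp add: \<iota>_1 semivaluation_1[OF semivaluation_vbar])
  \<comment> \<open>Uniformity makes the sum over roots of \<open>f\<close> the same for every root
    \<open>b\<close> of \<open>Q\<close>. Symmetry of the distance then allows the order of
    summation to be exchanged.\<close>
  have "trunc_poly w Q f = (\<Sum>a\<in>#A. min (Fin g) (vbar (a - b)))" if "b \<in># B" for b
    using Q(2) that B(2) V_prod[OF A, of b g] semivaluation_minus_commute[OF semivaluation_vbar, of b]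
    unfolding root_uniform_def g f one by simp
  then have "(\<Sum>b\<in>#B. trunc_poly w Q f) = (\<Sum>b\<in>#B. \<Sum>a\<in>#A. min (Fin g) (vbar (a - b)))"
    by (rule sum_mset_cong')
  also have "\<dots> = (\<Sum>a\<in>#A. \<Sum>b\<in>#B. min (Fin g) (vbar (a - b)))" by (rule sum_mset.swap)
  also have "\<dots> = (\<Sum>a\<in>#A. V a (\<delta> Q) Q)"
    using V_prod[OF B(3), of _ g] unfolding key_lead_coeff[OF Q(1)] one g by simp
  finally show ?thesis by (simp add: sum_mset_const B(1))
qed

text \<open>Each root of \<open>f\<close> contributes at most \<open>wp Q\<close> to the double sum,
  and one at which \<open>V\<close> differs from the truncation contributes strictly less, which the
  bound \<open>ext\<close> does not permit.\<close>

lemma trunc_poly_extremal: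
  assumes Q: "key Q" "root_uniform Q" and f: "lead_coeff f = 1"
    and ext: "nmult (degree f) (wp Q) \<le> nmult (degree Q) (trunc_poly w Q f)"
    and a: "poly (E f) a = 0"
  shows "V a (\<delta> Q) h = trunc_poly w Q h"
proof (rule ccontr)
  assume *: "\<not> ?thesis"
  obtain g where g: "\<delta> Q = Fin g" using delta_finite[OF key_degree[OF Q(1)]] by blast
  have nz: "Q \<noteq> 0" using key_degree[OF Q(1)] by auto
  have "f \<noteq> 0" using f by auto
  then obtain A where A: "size A = degree f" "set_mset A = {x. poly (E f) x = 0}"
    "E f = smult (\<iota> (lead_coeff f)) (\<Prod>x\<in>#A. [:- x, 1:])"
    using roots_E by blast
  have "V a (\<delta> Q) Q < wp Q"
    using V_eq_trunc_poly_or_eval_less[OF Q, of a] * V_le_eval[of a g Q] unfolding g by auto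
  moreover have "V x (\<delta> Q) Q \<noteq> Minf" "V x (\<delta> Q) Q \<noteq> Pinf" for x
    unfolding g using nz by (simp_all add: semivaluation_neq_Minf[OF semivaluation_V] V_eq_Pinf_iff)
  ultimately have "(\<Sum>x\<in>#A. V x (\<delta> Q) Q) < (\<Sum>x\<in>#A. wp Q)"
    using a A(2) by (intro sum_mset_less[of _ _ _ a] V_key_le_wp[OF Q]) simp_all
  then show False
    using ext double_root_sum[OF Q f A(3)] by (simp add: sum_mset_const A(1))
qed

lemma trunc_poly_all_close:
  assumes Q: "key Q" "root_uniform Q" and f: "lead_coeff f = 1"
    and close: "\<And>a. poly (E f) a = 0 \<Longrightarrow> V a (\<delta> Q) Q = wp Q"
  shows "nmult (degree Q) (trunc_poly w Q f) = nmult (degree f) (wp Q)"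
proof -
  have "f \<noteq> 0" using f by auto
  then obtain A where A: "size A = degree f" "set_mset A = {x. poly (E f) x = 0}"
    "E f = smult (\<iota> (lead_coeff f)) (\<Prod>x\<in>#A. [:- x, 1:])"
    using roots_E by blast
  have "(\<Sum>x\<in>#A. V x (\<delta> Q) Q) = (\<Sum>x\<in>#A. wp Q)"
    by (rule sum_mset_cong') (use close A(2) in simp)
  then show ?thesis using double_root_sum[OF Q f A(3)] by (simp add: sum_mset_const A(1))
qed

text \<open>At an optimizing root of \<open>Q\<close>, the constant coefficient of a polynomial of smaller degree
  strictly dominates the others.\<close>

lemma key_hasse_greater:
  assumes Q: "key Q" and f: "degree f < degree Q" "degree f > 0" "l > 0"
    and h: "\<And>b. poly (E h) b = coeff (pcompose (E f) [:b, 1:]) l" "degree h < degree f"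
  shows "wp f < wp h + nmult l (\<delta> Q)"
proof (cases "h = 0")
  case True
  have "f \<noteq> 0" using f(2) by auto
  then show ?thesis using wp_finite[of f] by (auto simp: True semivaluation_0[OF semivaluation_wp])
next
  case False
  have nz: "f \<noteq> 0" using f(2) by auto
  obtain a where a: "poly (E Q) a = 0" "W [:- a, 1:] = \<delta> Q"
    using delta_attained[OF key_degree[OF Q]] by blast
  obtain z where z: "poly (E f) z = 0" "W [:- z, 1:] = \<delta> f"
    using delta_attained[OF f(2)] by blast
  obtain e where e: "\<delta> f = Fin e" using delta_finite[OF f(2)] by blast
  have less: "Fin e < \<delta> Q" using key_delta_less[OF Q nz f(1)] e by simp
  \<comment> \<open>\<open>V_eq_wp\<close> at radius \<open>e\<close> needs a center whose distance
    to X is exactly \<open>e\<close>. This is \<open>z\<close>, and \<open>a\<close> lies in the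
    same ball. Enlarging the radius from \<open>e\<close> to \<open>\<delta> Q\<close> afterwards
    makes the inequality strict.\<close>
  have "Fin e \<le> vbar (a - z)"
    by (rule vbar_diff_ge) (use a z e less in simp_all)
  then have "V a (Fin e) f = V z (Fin e) f" by (rule V_center_cong)
  also have "\<dots> = wp f" by (rule V_eq_wp) (use z e in simp_all)
  finally have "wp f \<le> vbar (poly (E h) a) + nmult l (Fin e)"
    using mono_val_poly_le_coeff[OF vbar, of a e "E f" l] by (simp add: h(1))
  also have "vbar (poly (E h) a) = wp h"
    by (rule key_small_eval[OF Q a(2)]) (use h(2) f(1) in simp)
  also have "wp h + nmult l (Fin e) < wp h + nmult l (\<delta> Q)"
  proof -
    have "nmult l (Fin e) < nmult l (\<delta> Q)" by (rule nmult_strict_mono[OF less]) (use f(3) in simp_all)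
    then show ?thesis
      unfolding add.commute[of "wp h"] by (rule extended_add_less_le) (use wp_finite[OF False] in auto)
  qed
  finally show ?thesis .
qed

text \<open>If \<open>f\<close> vanished at \<open>c\<close>, the minimum defining
  \<open>V c (\<delta> Q) f\<close> would be attained at a positive index. The Hasse derivative at
  that index would then contradict \<open>key_hasse_greater\<close>.\<close>

lemma small_eval_nonzero:
  assumes Q: "key Q" and close: "\<And>f. V c (\<delta> Q) f = trunc_poly w Q f"
    and f: "f \<noteq> 0" "degree f < degree Q"
  shows "poly (E f) c \<noteq> 0"
proof
  assume root: "poly (E f) c = 0"
  have deg: "degree f > 0"
  proof (rule ccontr)
    assume "\<not> ?thesis"
    then obtain c where "f = [:c:]" by (auto elim: degree_eq_zeroE)
    with f(1) root show False by (simp add: map_poly_pCons \<iota>_0 \<iota>_eq_0_iff)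
  qed
  obtain g where g: "\<delta> Q = Fin g" using delta_finite[OF key_degree[OF Q]] by blast
  obtain i where i: "V c (Fin g) f = vbar (coeff (pcompose (E f) [:c, 1:]) i) + nmult i (Fin g)"
    using mono_val_poly_attained[OF vbar] by blast
  have V: "V c (Fin g) f = wp f" using close[of f] trunc_poly_small[OF Q f(2)] g by simp
  show False
  proof (cases "i = 0")
    case True
    then show False using i V root wp_finite[OF f(1)] by (simp add: semivaluation_0[OF semivaluation_vbar])
  next
    case False
    then obtain h where h: "degree h < degree f" "\<And>b. poly (E h) b = coeff (pcompose (E f) [:b, 1:]) i"
      using hasse_derivative[OF deg, of i] by auto
    have "wp h \<le> vbar (poly (E h) c)"
      using V_le_eval[of c g h] close[of h] trunc_poly_small[OF Q, of h] h(1) f(2) g by simp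
    then have "wp h + nmult i (Fin g) \<le> wp f"
      unfolding V[symmetric] i h(2)[symmetric] by (rule add_right_mono)
    then show False
      using key_hasse_greater[OF Q f(2) deg, of i h] h False g by simp
  qed
qed

text \<open>In each Horner step the product with \<open>Q\<close> exceeds \<open>c0\<close> in
  degree, so adding \<open>c0\<close> affects neither degree nor leading coefficient.\<close>

lemma degree_lead_coeff_expansion:
  fixes Q :: "'k poly"
  assumes Q: "lead_coeff Q = 1" "degree Q > 0" and "c \<noteq> 0" "\<forall>t. degree (coeff c t) < degree Q"
  shows "degree (poly c Q) = degree c * degree Q + degree (lead_coeff c) \<and>
    lead_coeff (poly c Q) = lead_coeff (lead_coeff c)"
  using assms(3,4)
proof (induction c)
  case (pCons c0 c)
  show ?case
  proof (cases "c = 0")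
    case False
    have c0: "degree c0 < degree Q" using pCons.prems by (metis coeff_pCons_0)
    have c: "\<forall>t. degree (coeff c t) < degree Q" using pCons.prems by (metis coeff_pCons_Suc)
    note IH = pCons.IH[OF False c]
    have nz: "poly c Q \<noteq> 0" using IH False by (metis leading_coeff_0_iff)
    have Q0: "Q \<noteq> 0" using Q by auto
    have deg: "degree (Q * poly c Q) = degree Q + degree (poly c Q)" using nz Q0 by (rule degree_mult_eq[rotated])
    have lt: "degree c0 < degree (Q * poly c Q)" using c0 deg by simp
    have "degree (c0 + Q * poly c Q) = degree (Q * poly c Q)" using lt by (rule degree_add_eq_right)
    then have degree_sum: "degree (c0 + Q * poly c Q) = Suc (degree c) * degree Q + degree (lead_coeff c)"
      using IH deg by simp
    have "lead_coeff (c0 + Q * poly c Q) = lead_coeff (Q * poly c Q)"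
      using lt by (metis add.commute lead_coeff_add_le)
    also have "\<dots> = lead_coeff (poly c Q)" unfolding lead_coeff_mult Q(1) by simp
    also have "\<dots> = lead_coeff (lead_coeff c)" using IH by (rule conjunct2)
    finally have "lead_coeff (c0 + Q * poly c Q) = lead_coeff (lead_coeff c)" .
    with degree_sum show ?thesis using False by simp
  qed simp
qed simp

lemma regular_expansion_if_root_uniform:
  assumes Q: "key Q" "root_uniform Q" and F: "key F" "root_uniform F" and deg: "degree Q < degree F"
  shows "regular_expansion w Q F"
proof -
  have Q0: "Q \<noteq> 0" using key_degree[OF Q(1)] by auto
  have less: "\<delta> Q < \<delta> F" by (rule key_delta_less[OF F(1) Q0 deg])
  obtain g where g: "\<delta> Q = Fin g" using delta_finite[OF key_degree[OF Q(1)]] by blast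
  obtain d where d: "\<delta> F = Fin d" using delta_finite[OF key_degree[OF F(1)]] by blast
  have wQ: "\<exists>q. wp Q = Fin q" by (rule wp_finite[OF Q0])
  \<comment> \<open>Uniformity of \<open>F\<close> shows that \<open>Q\<close> has value at least
    \<open>wp Q\<close> at every root of \<open>F\<close>, which rules out the second case of the
    dichotomy for \<open>Q\<close>.\<close>
  have close: "V a (\<delta> Q) f = trunc_poly w Q f" if "poly (E F) a = 0" for a f
  proof -
    have "V a (\<delta> F) Q = trunc_poly w F Q" using F(2) that unfolding root_uniform_def by blast
    also have "\<dots> = wp Q" by (rule trunc_poly_small[OF F(1) deg])
    finally have "\<not> vbar (poly (E Q) a) < wp Q" using V_le_eval[of a d Q] d by simp
    then show ?thesis using V_eq_trunc_poly_or_eval_less[OF Q, of a] by blast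
  qed
  define c where "c = q_expansion Q F"
  define n where "n = degree c"
  have c: "poly c Q = F" "\<forall>t. degree (coeff c t) < degree Q"
    using q_expansion[OF key_degree[OF Q(1)], of F] by (simp_all add: c_def)
  have "c \<noteq> 0" using c(1) key_degree[OF F(1)] by auto
  from degree_lead_coeff_expansion[OF key_lead_coeff[OF Q(1)] key_degree[OF Q(1)] this c(2)]
  have degF: "degree F = n * degree Q + degree (lead_coeff c)" and lc: "lead_coeff (lead_coeff c) = 1"
    using key_lead_coeff[OF F(1)] by (simp_all add: c(1) n_def)
  have lc0: "lead_coeff c \<noteq> 0" using \<open>c \<noteq> 0\<close> by simp
  have lcdeg: "degree (lead_coeff c) < degree Q" using c(2) by simp
  have ext: "nmult (degree Q) (trunc_poly w Q F) = nmult (degree F) (wp Q)"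
    by (rule trunc_poly_all_close[OF Q key_lead_coeff[OF F(1)]])
       (simp add: close trunc_poly_eq_wp[OF Q(1)])
  have term_ge: "trunc_poly w Q F \<le> wp (coeff c t) + nmult t (wp Q)" for t
    using trunc_poly_ge_iff[OF key_degree[OF Q(1)], of "trunc_poly w Q F" F] by (simp add: c_def)
  \<comment> \<open>The leading term of the expansion bounds the truncation from above. Cancelling
    \<open>n * degree Q\<close> copies of \<open>wp Q\<close> leaves the extremal inequality for the
    leading coefficient alone.\<close>
  have "nmult (degree F) (wp Q) \<le> nmult (degree Q) (wp (lead_coeff c) + nmult n (wp Q))"
    unfolding ext[symmetric] n_def by (intro nmult_mono term_ge)
  then have "nmult (degree (lead_coeff c)) (wp Q) + nmult (n * degree Q) (wp Q)
      \<le> nmult (degree Q) (wp (lead_coeff c)) + nmult (n * degree Q) (wp Q)"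
    by (simp add: degF nmult_add nmult_add_right nmult_mult nmult_commute[of "degree Q"] add.commute)
  then have lc_ext: "nmult (degree (lead_coeff c)) (wp Q) \<le> nmult (degree Q) (wp (lead_coeff c))"
    by (subst (asm) extended_add_right_le_cancel) (use wQ in \<open>auto simp: nmult_Fin\<close>)
  \<comment> \<open>A nonconstant leading coefficient would have a root, close to \<open>Q\<close>
    by extremality, although its degree is below that of \<open>Q\<close>.\<close>
  have deg0: "degree (lead_coeff c) = 0"
  proof (rule ccontr)
    assume "\<not> ?thesis"
    then obtain x where x: "poly (E (lead_coeff c)) x = 0"
      using delta_attained[of "lead_coeff c"] by auto
    have "V x (\<delta> Q) f = trunc_poly w Q f" for f
      by (rule trunc_poly_extremal[OF Q lc _ x]) (use lc_ext trunc_poly_small[OF Q(1) lcdeg] in simp)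
    from small_eval_nonzero[OF Q(1) this lc0 lcdeg] x show False by blast
  qed
  then have lc1: "lead_coeff c = 1" using lc by (metis degree_eq_zeroE lead_coeff_pCons(2) one_pCons)
  have "nmult (degree Q) (trunc_poly w Q F) = nmult (degree Q) (nmult n (wp Q))"
    using ext unfolding degF deg0 by (simp add: nmult_mult nmult_commute[of "degree Q"])
  then have tr: "trunc_poly w Q F = nmult n (wp Q)"
    by (rule nmult_cancel)
       (use wQ semivaluation_neq_Minf[OF semivaluation_trunc_poly[OF Q(1)]] key_degree[OF Q(1)] in \<open>auto simp: nmult_Fin\<close>)
  show ?thesis
    unfolding regular_expansion_def Let_def c_def[symmetric] n_def[symmetric]
    using lc1 tr term_ge[folded tr] by (simp add: tr n_def)
qed

text \<open>If \<open>f\<close> is a polynomial of least degree with \<open>v (f a) \<noteq> w f\<close>, dividing \<open>F\<close> by \<open>f\<close> shows that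
  some truncation below \<open>F\<close> already attains \<open>w F\<close>.\<close>

lemma key_root_limit:
  assumes F: "key F" and a: "poly (E F) a = 0"
    and near: "\<And>f. f \<noteq> 0 \<Longrightarrow> degree f < degree F \<Longrightarrow>
      \<exists>q. key q \<and> \<delta> f \<le> \<delta> q \<and> \<delta> q < \<delta> F \<and> (\<forall>x. V a (\<delta> q) x = trunc_poly w q x)"
  shows "V a (\<delta> F) f = trunc_poly w F f"
proof -
  obtain d where d: "\<delta> F = Fin d" using delta_finite[OF key_degree[OF F]] by blast
  have V_le: "trunc_poly w q f \<le> V a (\<delta> F) f"
    if q: "key q" "\<delta> q < \<delta> F" "\<forall>x. V a (\<delta> q) x = trunc_poly w q x" for q f
  proof -
    obtain g where g: "\<delta> q = Fin g" using delta_finite[OF key_degree[OF q(1)]] by blast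
    show ?thesis using q V_mono[of g d a f] g d by simp
  qed
  \<comment> \<open>A \<open>q\<close> with \<open>\<delta> f \<le> \<delta> q\<close> computes
    \<open>wp f\<close> by its truncation, which is \<open>V\<close> at \<open>a\<close> with a
    smaller radius.\<close>
  have ge: "wp f \<le> V a (\<delta> F) f" if "degree f < degree F" for f
  proof (cases "f = 0")
    case True
    then show ?thesis using semivaluation_0[OF semivaluation_V, of a d] d by simp
  next
    case False
    then show ?thesis using near[OF False that] V_le trunc_poly_eq_wp by metis
  qed
  have eval: "vbar (poly (E f) a) = wp f" if "degree f < degree F" for f
    using that
  proof (induction "degree f" arbitrary: f rule: less_induct)
    case less
    let ?u = "\<lambda>f. vbar (poly (E f) a)"
    have le: "wp h \<le> ?u h" if "degree h < degree F" for h
      using ge[OF that] V_le_eval[of a d h] d by simp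
    show ?case
    proof (rule ccontr)
      assume neq: "?u f \<noteq> wp f"
      with le[OF less.prems] have gt: "wp f < ?u f" by simp
      have f0: "f \<noteq> 0" using neq
        by (auto simp: semivaluation_0[OF semivaluation_wp] semivaluation_0[OF semivaluation_vbar])
      have "degree f > 0"
      proof (rule ccontr)
        assume "\<not> ?thesis"
        then obtain c where c: "f = [:c:]" by (auto elim: degree_eq_zeroE)
        have "wp f = vbar (\<iota> c)" using W_E[of f] extends_vbar by (simp add: c map_poly_pCons \<iota>_0)
        with neq show False by (simp add: c map_poly_pCons \<iota>_0)
      qed
      define h where "h = F div f"
      define r where "r = F mod f"
      have Fhr: "F = h * f + r" by (simp add: h_def r_def)
      have r: "degree r < degree f"
        using degree_mod_less[OF f0, of F] \<open>degree f > 0\<close> by (auto simp: r_def)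
      have h0: "h \<noteq> 0" using Fhr r less.prems by auto
      have "degree F = degree h + degree f"
        using Fhr r degree_add_eq_left[of r "h * f"] h0 f0 by (simp add: degree_mult_eq)
      then have h: "degree h < degree F" using \<open>degree f > 0\<close> by simp
      \<comment> \<open>One truncation has to compute \<open>w\<close> on \<open>f\<close>,
        \<open>h\<close> and \<open>r\<close> simultaneously; it is chosen for the nonzero one among
        them with the largest \<open>\<delta>\<close>.\<close>
      have "\<exists>q. key q \<and> \<delta> q < \<delta> F \<and> (\<forall>p\<in>{f, h, r}. trunc_poly w q p = wp p)"
      proof -
        define S where "S = {f, h, r} - {0}"
        have S: "finite S" "S \<noteq> {}" using f0 by (auto simp: S_def)
        have "Max (\<delta> ` S) \<in> \<delta> ` S" using S by simp
        then obtain m where m: "m \<in> S" "\<delta> m = Max (\<delta> ` S)" by auto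
        have mmax: "\<delta> p \<le> \<delta> m" if "p \<in> S" for p using S that by (simp add: m(2))
        have "m \<noteq> 0" "degree m < degree F" using m(1) less.prems h r by (auto simp: S_def)
        then obtain q where q: "key q" "\<delta> m \<le> \<delta> q" "\<delta> q < \<delta> F" using near by blast
        have "trunc_poly w q p = wp p" if "p \<in> {f, h, r}" for p
        proof (cases "p = 0")
          case True
          then show ?thesis
            using semivaluation_0[OF semivaluation_trunc_poly[OF q(1)]] semivaluation_0[OF semivaluation_wp] by simp
        next
          case False
          then show ?thesis using mmax[of p] q that by (intro trunc_poly_eq_wp) (auto simp: S_def)
        qed
        with q show ?thesis by blast
      qed
      then obtain q where q: "key q" "\<delta> q < \<delta> F" and eq: "trunc_poly w q f = wp f"
        "trunc_poly w q h = wp h" "trunc_poly w q r = wp r" by auto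
      note u = semivaluation_eval_E[of a]
      \<comment> \<open>At the root \<open>a\<close> of \<open>F\<close>, \<open>r\<close> and
        \<open>h * f\<close> differ only by sign, and \<open>r\<close> already satisfies the claim
        because its degree is smaller than that of \<open>f\<close>.\<close>
      have "poly (E r) a = - poly (E (h * f)) a"
        using a Fhr by (metis E_add poly_add add_eq_0_iff2 add.commute)
      then have "?u r = ?u (h * f)" using semivaluation_minus[OF semivaluation_vbar] by simp
      moreover have "?u r = wp r" using less.hyps[OF r] r less.prems by simp
      ultimately have ur: "wp r = ?u h + ?u f" using semivaluation_mult[OF u, of h f] by simp
      \<comment> \<open>The excess at \<open>f\<close> makes \<open>wp (h * f)\<close> smaller than
        \<open>wp r\<close>. Hence \<open>h * f\<close> determines the value of \<open>F\<close>
        both under \<open>w\<close> and under the truncation at \<open>q\<close>, contrary to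
        \<open>\<delta> q < \<delta> F\<close>.\<close>
      have "wp f + wp h < ?u f + ?u h"
        by (rule extended_add_less_le[OF gt le[OF h]]) (use wp_finite[OF h0] in auto)
      then have lt: "wp (h * f) < wp r"
        unfolding ur by (simp add: semivaluation_mult[OF semivaluation_wp] add.commute)
      then have "wp F = wp (h * f)" unfolding Fhr by (rule semivaluation_add_eq[OF semivaluation_wp])
      moreover have tr: "trunc_poly w q (h * f) = wp (h * f)"
        using semivaluation_mult[OF semivaluation_trunc_poly[OF q(1)], of h f]
          semivaluation_mult[OF semivaluation_wp, of h f] eq by simp
      then have "trunc_poly w q F = wp (h * f)" unfolding Fhr
        using semivaluation_add_eq[OF semivaluation_trunc_poly[OF q(1)], of "h * f" r] lt eq by simp
      ultimately show False using trunc_poly_less_wp[OF q(1) key_degree[OF F] q(2)] by simp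
    qed
  qed
  show ?thesis by (rule key_root_V_eq_trunc_poly[OF F a eval ge])
qed

section \<open>Regular sequences\<close>

text \<open>The only root attains \<open>\<delta> Q\<close>. This starts the induction over blocks,
  since \<open>Q (e 0)\<close> is X.\<close>

lemma root_uniform_linear:
  assumes Q: "key Q" and deg: "degree Q = 1"
  shows "root_uniform Q"
  unfolding root_uniform_def
proof (intro allI impI)
  fix a f assume a: "poly (E Q) a = 0"
  have "Q \<noteq> 0" using deg by auto
  then obtain A where A: "size A = degree Q" "set_mset A = {x. poly (E Q) x = 0}"
    using roots_E by blast
  then obtain x where x: "A = {#x#}" using deg size_1_singleton_mset by metis
  obtain b where "poly (E Q) b = 0" "W [:- b, 1:] = \<delta> Q"
    using delta_attained[OF key_degree[OF Q]] by blast
  moreover have "b = a"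
  proof -
    have "b \<in> set_mset A" "a \<in> set_mset A" using calculation(1) a by (simp_all add: A(2))
    then show ?thesis by (simp add: x)
  qed
  ultimately show "V a (\<delta> Q) f = trunc_poly w Q f" using key_trunc_poly[OF Q] by simp
qed

text \<open>Regularity speaks of the member \<open>G = Q (e (Suc j))\<close> of a block; this
  carries its truncated value to other members \<open>F\<close>. If the value of \<open>F\<close>
  were smaller, \<open>F - G\<close> would determine the value of \<open>F\<close> under both
  \<open>w\<close> and the truncation. These agree on \<open>F - G\<close> but not on
  \<open>F\<close>.\<close>

lemma trunc_poly_ge_perturb:
  assumes q: "key q" and F: "key F" "\<delta> q < \<delta> F" and close: "\<delta> (F - G) \<le> \<delta> q"
  shows "trunc_poly w q G \<le> trunc_poly w q F"
proof (rule ccontr)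
  let ?T = "trunc_poly w q" and ?h = "F - G"
  note T = semivaluation_trunc_poly[OF q]
  assume less: "\<not> ?thesis"
  have F': "F = ?h + G" by simp
  have Th: "?T ?h = wp ?h" by (rule trunc_poly_eq_wp[OF q close])
  have hG: "?T ?h < ?T G"
  proof (rule ccontr)
    assume "\<not> ?thesis"
    then have "?T G \<le> ?T (?h + G)" by (intro semivaluation_add_ge[OF T]) auto
    with less show False by simp
  qed
  have "?T F = wp ?h" using semivaluation_add_eq[OF T hG] Th by simp
  moreover have "wp ?h < wp G" using hG trunc_poly_le_wp[OF q, of G] Th by simp
  then have "wp F = wp ?h" using semivaluation_add_eq[OF semivaluation_wp, of ?h G] by simp
  ultimately show False using trunc_poly_less_wp[OF q key_degree[OF F(1)] F(2)] by simp
qed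

text \<open>With leading coefficient 1, the degree of \<open>G\<close> is a multiple of that of
  \<open>q\<close>, and the regular value is exactly the extremal one. The perturbation bound passes
  it to \<open>F\<close>.\<close>

lemma regular_expansion_close:
  assumes q: "key q" "root_uniform q" and F: "key F" "\<delta> q < \<delta> F"
    and G: "lead_coeff G = 1" "degree G = degree F" "regular_expansion w q G"
    and close: "\<delta> (F - G) \<le> \<delta> q"
    and a: "poly (E F) a = 0"
  shows "V a (\<delta> q) f = trunc_poly w q f"
proof -
  define c where "c = q_expansion q G"
  have c: "poly c q = G" "\<forall>t. degree (coeff c t) < degree q"
    using q_expansion[OF key_degree[OF q(1)], of G] by (simp_all add: c_def)
  have "c \<noteq> 0" using c(1) G(1) by auto
  have reg: "lead_coeff c = 1" "trunc_poly w q G = nmult (degree c) (wp q)"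
    using G(3) unfolding regular_expansion_def Let_def c_def by auto
  have "degree G = degree c * degree q"
    using degree_lead_coeff_expansion[OF key_lead_coeff[OF q(1)] key_degree[OF q(1)] \<open>c \<noteq> 0\<close> c(2)] reg(1)
    by (simp add: c(1))
  then have "nmult (degree F) (wp q) = nmult (degree q) (trunc_poly w q G)"
    by (simp add: G(2)[symmetric] reg(2) nmult_mult nmult_commute[of "degree q"])
  also have "\<dots> \<le> nmult (degree q) (trunc_poly w q F)"
    by (intro nmult_mono trunc_poly_ge_perturb[OF q(1) F close])
  finally show ?thesis by (rule trunc_poly_extremal[OF q key_lead_coeff[OF F(1)] _ a])
qed

theorem regular_sequence_iff_root_uniform:
  fixes \<Lambda> :: "'i::linorder set" and Q :: "'i \<Rightarrow> 'k poly"
  assumes complete: "complete_key_sequence \<iota> wbar w \<Lambda> Q"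
    and normalized: "normalized_sequence \<iota> wbar w \<Lambda> I e \<theta> Q"
  shows "regular_sequence w I e \<theta> Q \<longleftrightarrow> (\<forall>i\<in>\<Lambda>. root_uniform (Q i))"
proof -
  have keyQ: "key (Q i)" if "i \<in> \<Lambda>" for i
    using complete that unfolding complete_key_sequence_def by blast
  have delta_mono: "\<delta> (Q i) \<le> \<delta> (Q k)" if "i \<in> \<Lambda>" "k \<in> \<Lambda>" "i \<le> k" for i k
    using complete that unfolding complete_key_sequence_def by (metis order_le_less)
  have I0: "0 \<in> I" and down: "\<forall>j\<in>I. \<forall>k<j. k \<in> I"
    and \<Lambda>: "\<Lambda> = (\<Union>j\<in>I. block e \<theta> j)" and Q0: "Q (e 0) = [:0, 1:]"
    and order': "\<forall>j. Suc j \<in> I \<longrightarrow> (\<forall>i\<in>\<theta> j. e j < i \<and> i < e (Suc j))"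
    and same_degree': "\<forall>j\<in>I. \<forall>i\<in>block e \<theta> j. \<forall>i'\<in>block e \<theta> j. degree (Q i) = degree (Q i')"
    and degree_Suc': "\<forall>j. Suc j \<in> I \<longrightarrow>
        (\<forall>i\<in>block e \<theta> j. \<forall>i'\<in>block e \<theta> (Suc j). degree (Q i) < degree (Q i'))"
    using normalized unfolding normalized_sequence_def by - (elim conjE, assumption)+
  have I_Suc: "j \<in> I" if "Suc j \<in> I" for j
    using down that by blast
  have order: "e j < i" if "Suc j \<in> I" "i \<in> \<theta> j" for i j
    using order' that by blast
  have same_degree: "degree (Q i) = degree (Q k)" if "j \<in> I" "i \<in> block e \<theta> j" "k \<in> block e \<theta> j" for i j k
    using same_degree' that by blast
  have degree_Suc: "degree (Q i) < degree (Q k)"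
    if "Suc j \<in> I" "i \<in> block e \<theta> j" "k \<in> block e \<theta> (Suc j)" for i j k
    using degree_Suc' that by blast
  have in_\<Lambda>: "i \<in> \<Lambda>" if "j \<in> I" "i \<in> block e \<theta> j" for i j
    using that \<Lambda> by blast
  have e_block: "e j \<in> block e \<theta> j" and \<theta>_block: "i \<in> \<theta> j \<Longrightarrow> i \<in> block e \<theta> j" for i j
    by (simp_all add: block_def)
  have degree_less: "degree (Q i) < degree (Q k)"
    if "j < m" "m \<in> I" "i \<in> block e \<theta> j" "k \<in> block e \<theta> m" for i j k m
    using that
  proof (induction m arbitrary: k)
    case (Suc m)
    show ?case
    proof (cases "j = m")
      case True
      then show ?thesis using degree_Suc Suc.prems by blast
    next
      case False
      then have "degree (Q i) < degree (Q (e m))"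
        using Suc.IH[of "e m"] Suc.prems I_Suc e_block by simp
      also have "\<dots> < degree (Q k)" using degree_Suc Suc.prems e_block by blast
      finally show ?thesis .
    qed
  qed simp
  show ?thesis
  proof
    assume uniform: "\<forall>i\<in>\<Lambda>. root_uniform (Q i)"
    have "regular_expansion w (Q i) (Q (e (Suc j)))" if "Suc j \<in> I" "i \<in> block e \<theta> j" for i j
      using that uniform keyQ degree_Suc[OF that e_block] in_\<Lambda>[OF I_Suc[OF that(1)] that(2)] in_\<Lambda>[OF that(1) e_block]
      by (intro regular_expansion_if_root_uniform) auto
    then show "regular_sequence w I e \<theta> Q"
      unfolding regular_sequence_def using e_block \<theta>_block by blast
  next
    assume regular: "regular_sequence w I e \<theta> Q"
    have "\<forall>i\<in>block e \<theta> j. root_uniform (Q i)" if "j \<in> I" for j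
      using that
    proof (induction j)
      case 0
      show ?case
      proof
        fix i assume i: "i \<in> block e \<theta> 0"
        have "degree (Q i) = 1" using same_degree[OF I0 i e_block] Q0 by simp
        then show "root_uniform (Q i)" by (rule root_uniform_linear[OF keyQ[OF in_\<Lambda>[OF I0 i]]])
      qed
    next
      case (Suc j)
      let ?G = "Q (e (Suc j))"
      have j: "j \<in> I" using I_Suc[OF Suc.prems] .
      have G: "lead_coeff ?G = 1" using key_lead_coeff keyQ in_\<Lambda>[OF Suc.prems e_block] by blast
      \<comment> \<open>\<open>S\<close> holds the indices of block \<open>j\<close> at which
        regularity gives an expansion: \<open>e j\<close> alone if \<open>\<theta> j\<close> is
        empty, otherwise a tail of \<open>\<theta> j\<close>. It is cofinal in the block and closed
        under \<open>max\<close>.\<close>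
      obtain S where S: "S \<subseteq> block e \<theta> j" "\<And>i. i \<in> S \<Longrightarrow> regular_expansion w (Q i) ?G"
        "\<And>i k. i \<in> S \<Longrightarrow> k \<in> S \<Longrightarrow> max i k \<in> S" "\<And>i. i \<in> block e \<theta> j \<Longrightarrow> \<exists>k\<in>S. i \<le> k"
      proof (cases "\<theta> j = {}")
        case True
        then have "regular_expansion w (Q (e j)) ?G"
          using regular j Suc.prems unfolding regular_sequence_def by blast
        then show thesis using that[of "{e j}"] True by (simp add: block_def)
      next
        case False
        then obtain i0 where i0: "i0 \<in> \<theta> j" "\<And>i. i \<in> \<theta> j \<Longrightarrow> i0 \<le> i \<Longrightarrow> regular_expansion w (Q i) ?G"
          using regular Suc.prems unfolding regular_sequence_def by blast
        show thesis
        proof (rule that[of "{i \<in> \<theta> j. i0 \<le> i}"])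
          fix i assume "i \<in> block e \<theta> j"
          then have "i \<le> max i i0" "max i i0 \<in> \<theta> j"
            using order[OF Suc.prems i0(1)] i0(1) by (auto simp: block_def max_def)
          then show "\<exists>k\<in>{i \<in> \<theta> j. i0 \<le> i}. i \<le> k" by (intro bexI[of _ "max i i0"]) auto
        qed (use i0 in \<open>auto simp: block_def max_def\<close>)
      qed
      have S_\<Lambda>: "k \<in> \<Lambda>" if "k \<in> S" for k using in_\<Lambda>[OF j] that S(1) by blast
      \<comment> \<open>Completeness gives a \<open>Q i\<close> of degree at most
        \<open>degree f\<close> whose truncation computes \<open>wp f\<close>, hence
        \<open>\<delta> f \<le> \<delta> (Q i)\<close>. Its degree puts \<open>i\<close> into a
        block up to \<open>j\<close>, and \<open>S\<close> dominates all of these.\<close>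
      have cofinal: "\<exists>k\<in>S. \<delta> f \<le> \<delta> (Q k)" if f: "degree f < degree ?G" for f
      proof (cases "degree f = 0")
        case True
        then show ?thesis using S(4)[OF e_block] by (auto simp: delta_def)
      next
        case False
        then obtain i where i: "i \<in> \<Lambda>" "degree (Q i) \<le> degree f" "wp f = trunc_poly w (Q i) f"
          using complete unfolding complete_key_sequence_def by blast
        have \<delta>i: "\<delta> f \<le> \<delta> (Q i)"
          using trunc_poly_less_wp[OF keyQ[OF i(1)], of f] i(3) False by force
        obtain l where l: "l \<in> I" "i \<in> block e \<theta> l" using i(1) \<Lambda> by blast
        have "\<not> Suc j < l" "l \<noteq> Suc j"
          using degree_less[OF _ l(1) e_block l(2), of "Suc j"] same_degree[OF l e_block] i(2) f by auto
        then have "l \<le> j" by simp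
        then consider "l < j" | "l = j" by linarith
        then show ?thesis
        proof cases
          case 1
          obtain k where k: "k \<in> S" using S(4)[OF e_block] by blast
          have "degree (Q i) < degree (Q k)" using degree_less[OF 1 j l(2)] k S(1) by blast
          moreover have "Q i \<noteq> 0" using key_degree[OF keyQ[OF i(1)]] by auto
          ultimately have "\<delta> (Q i) < \<delta> (Q k)" using key_delta_less[OF keyQ[OF S_\<Lambda>[OF k]]] by blast
          with \<delta>i k show ?thesis by (meson less_imp_le order.trans)
        next
          case 2
          then obtain k where "k \<in> S" "i \<le> k" using S(4) l(2) by blast
          then show ?thesis using \<delta>i delta_mono[OF i(1) S_\<Lambda>] by (meson order.trans)
        qed
      qed
      show ?case
      proof
        fix i assume i: "i \<in> block e \<theta> (Suc j)"
        let ?F = "Q i"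
        have F: "key ?F" using keyQ in_\<Lambda>[OF Suc.prems i] by blast
        have degF: "degree ?G = degree ?F" by (rule same_degree[OF Suc.prems e_block i])
        \<comment> \<open>Both are monic of equal degree, so \<open>cofinal\<close> covers their
          difference too. For \<open>i = e (Suc j)\<close> the difference is 0 and its
          \<open>\<delta>\<close> is \<open>Minf\<close>.\<close>
        have deg_diff: "degree (?F - ?G) < degree ?G"
        proof (rule degree_lessI)
          show "\<forall>k\<ge>degree ?G. coeff (?F - ?G) k = 0"
          proof (intro allI impI)
            fix k assume "degree ?G \<le> k"
            then consider "k = degree ?G" | "degree ?G < k" by linarith
            then show "coeff (?F - ?G) k = 0"
              by cases (use degF G key_lead_coeff[OF F] in \<open>simp_all add: coeff_eq_0\<close>)
          qed
        qed (use degF key_degree[OF F] in simp)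
        show "root_uniform ?F"
          unfolding root_uniform_def
        proof (intro allI impI)
          fix a f assume a: "poly (E ?F) a = 0"
          show "V a (\<delta> ?F) f = trunc_poly w ?F f"
          proof (rule key_root_limit[OF F a])
            fix h :: "'k poly" assume "degree h < degree ?F"
            then obtain k1 k2 where k: "k1 \<in> S" "\<delta> h \<le> \<delta> (Q k1)" "k2 \<in> S" "\<delta> (?F - ?G) \<le> \<delta> (Q k2)"
              using cofinal[of h] cofinal[OF deg_diff] degF by auto
            \<comment> \<open>A single index must dominate both \<open>h\<close> and the difference
              of \<open>?F\<close> and \<open>?G\<close>.\<close>
            define k where "k = max k1 k2"
            have kS: "k \<in> S" using S(3) k by (simp add: k_def)
            have le: "\<delta> (Q k1) \<le> \<delta> (Q k)" "\<delta> (Q k2) \<le> \<delta> (Q k)"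
              using delta_mono S_\<Lambda> k kS by (simp_all add: k_def)
            have key: "key (Q k)" using keyQ[OF S_\<Lambda>[OF kS]] .
            have "degree (Q k) < degree ?F" using degree_Suc[OF Suc.prems _ i] kS S(1) by blast
            moreover have "Q k \<noteq> 0" using key_degree[OF key] by auto
            ultimately have less: "\<delta> (Q k) < \<delta> ?F" using key_delta_less[OF F] by blast
            have "root_uniform (Q k)" using Suc.IH[OF j] kS S(1) by blast
            from regular_expansion_close[OF key this F less G degF S(2)[OF kS] _ a] k le
            have "V a (\<delta> (Q k)) x = trunc_poly w (Q k) x" for x by (meson order.trans)
            then show "\<exists>q. key q \<and> \<delta> h \<le> \<delta> q \<and> \<delta> q < \<delta> ?F \<and> (\<forall>x. V a (\<delta> q) x = trunc_poly w q x)"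
              using key k le less by (meson order.trans)
          qed
        qed
      qed
    qed
    then show "\<forall>i\<in>\<Lambda>. root_uniform (Q i)" using \<Lambda> by blast
  qed
qed

section \<open>Passage from polynomials to rational functions\<close>

lemma extended_diff_0: "x - 0 = (x :: 'g extended)"
  by (cases x) (simp_all add: zero_extended_def)

text \<open>Both valuations are multiplicative, so on a fraction each is the value of the numerator
  minus that of the denominator. Denominator 1, of value 0, recovers the polynomial
  statement.\<close>

lemma root_uniform_iff_fract:
  assumes Q: "key Q"
  shows "root_uniform Q \<longleftrightarrow>
    (\<forall>a. poly (E Q) a = 0 \<longrightarrow> (\<forall>x. mono_val vbar a (\<delta> Q) (embed_ratfun \<iota> x) = trunc w Q x))"
proof -
  obtain g where g: "\<delta> Q = Fin g" using delta_finite[OF key_degree[OF Q]] by blast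
  have mono: "mono_val vbar a (\<delta> Q) (embed_ratfun \<iota> (Fract p q)) = V a (\<delta> Q) p - V a (\<delta> Q) q"
    if "q \<noteq> 0" for a p q
    unfolding mono_val_def embed_ratfun_Fract[OF closure that] g
    by (rule fract_val_Fract)
       (use that in \<open>simp_all add: mono_val_poly_mult[OF vbar] mono_val_poly_neq_Minf[OF vbar]
          mono_val_poly_eq_Pinf_iff[OF vbar] E_eq_0_iff\<close>)
  note T = semivaluation_trunc_poly[OF Q]
  have trunc: "trunc w Q (Fract p q) = trunc_poly w Q p - trunc_poly w Q q" if "q \<noteq> 0" for p q
    unfolding trunc_def
    by (rule fract_val_Fract)
       (use that in \<open>simp_all add: semivaluation_mult[OF T] semivaluation_neq_Minf[OF T] trunc_poly_eq_Pinf_iff[OF Q]\<close>)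
  have "(\<forall>f. V a (\<delta> Q) f = trunc_poly w Q f) \<longleftrightarrow>
      (\<forall>x. mono_val vbar a (\<delta> Q) (embed_ratfun \<iota> x) = trunc w Q x)" for a
  proof
    assume *: "\<forall>f. V a (\<delta> Q) f = trunc_poly w Q f"
    show "\<forall>x. mono_val vbar a (\<delta> Q) (embed_ratfun \<iota> x) = trunc w Q x"
    proof
      fix x :: "'k poly fract"
      obtain p q where x: "x = Fract p q" "q \<noteq> 0" by (cases x) auto
      show "mono_val vbar a (\<delta> Q) (embed_ratfun \<iota> x) = trunc w Q x"
        unfolding x(1) mono[OF x(2)] trunc[OF x(2)] using * by simp
    qed
  next
    assume *: "\<forall>x. mono_val vbar a (\<delta> Q) (embed_ratfun \<iota> x) = trunc w Q x"
    show "\<forall>f. V a (\<delta> Q) f = trunc_poly w Q f"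
    proof
      fix f
      have "V a (\<delta> Q) f - V a (\<delta> Q) 1 = trunc_poly w Q f - trunc_poly w Q 1"
        using * mono[of 1 a f] trunc[of 1 f] by simp
      then show "V a (\<delta> Q) f = trunc_poly w Q f"
        using semivaluation_1[OF semivaluation_V, of a g] semivaluation_1[OF T] g
        by (simp only: extended_diff_0)
    qed
  qed
  then show ?thesis unfolding root_uniform_def by blast
qed

end

theorem theorem1p3:
  fixes \<iota> :: "'k::field \<Rightarrow> 'c::alg_closed_field"
    and v :: "'k \<Rightarrow> 'g::linordered_ab_group_add extended"
    and vbar :: "'c \<Rightarrow> 'g extended"
    and w :: "'k poly fract \<Rightarrow> 'g extended"
    and wbar :: "'c poly fract \<Rightarrow> 'g extended"
    and \<Lambda> :: "'i::linorder set"
    and I :: "nat set"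
    and e :: "nat \<Rightarrow> 'i"
    and \<theta> :: "nat \<Rightarrow> 'i set"
    and Q :: "'i \<Rightarrow> 'k poly"
  assumes "algebraic_closure_of \<iota>"
    and "valuation v" and "valuation vbar" and "valuation w" and "valuation wbar"
    and "\<forall>x. vbar (\<iota> x) = v x"
    and "\<forall>x. w (Fract [:x:] 1) = v x"
    and "\<forall>x. wbar (embed_ratfun \<iota> x) = w x"
    and "\<forall>z. wbar (Fract [:z:] 1) = vbar z"
    and "complete_key_sequence \<iota> wbar w \<Lambda> Q"
    and "normalized_sequence \<iota> wbar w \<Lambda> I e \<theta> Q"
  shows "regular_sequence w I e \<theta> Q \<longleftrightarrow>
         (\<forall>i\<in>\<Lambda>. \<forall>a. poly (map_poly \<iota> (Q i)) a = 0 \<longrightarrow>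
            (\<forall>x. mono_val vbar a (delta \<iota> wbar (Q i)) (embed_ratfun \<iota> x) = trunc w (Q i) x))"
proof -
  interpret valued_extension \<iota> vbar w wbar
    by unfold_locales (use assms in blast)+
  have "key_polynomial \<iota> wbar (Q i)" if "i \<in> \<Lambda>" for i
    using assms(10) that unfolding complete_key_sequence_def by blast
  then show ?thesis
    unfolding regular_sequence_iff_root_uniform[OF assms(10,11)] using root_uniform_iff_fract by blast
qed

end
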